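(* Let $\alpha_5:=1\in\mathbb{F}_5$ (which satisfies $7\alpha_5^3+7\alpha_5+1=0$ in $\mathbb{F}_5$). Over $\mathbb{F}_5$, with $\alpha=\alpha_5$, define \begin{align*} P :=\;& x\left[x^{6}-3\cdot 7\cdot x^{4}y^{2}+5\cdot 7\cdot x^{2}y^{4}-7 y^{6}\right]\\ & + 7z\left[(x^2+y^2)^3-2^3 z^{2}(x^2+y^2)^2+2^4 z^{4}(x^{2}+y^{2})\right]-2^6 z^{7},\\ U_\alpha :=\;& (z+a_5 w)\left((z+w)(x^2+y^2)+a_1z^3+a_2z^2w+a_3zw^2+a_4w^3\right)^2, \end{align*} where \begin{align*} a_1 &:= -\tfrac{12}{7}\alpha^2-\tfrac{384}{49}\alpha-\tfrac{8}{7}, & a_2 &:= -\tfrac{32}{7}\alpha^2+\tfrac{24}{49}\alpha-4,\\ a_3 &:= -4\alpha^2+\tfrac{24}{49}\alpha-4, & a_4 &:= -\tfrac{8}{7}\alpha^2+\tfrac{8}{49}\alpha-\tfrac{8}{7},\\ a_5 &:= 49\alpha^2-7\alpha+50, \end{align*} all integers and fractions being read in $\mathbb{F}_5$. Then the surface $S_{\alpha_5}\subset\mathbb{P}^3(\mathbb{F}_5)$ of degree $7$ defined by $P-U_{\alpha_5}=0$ has $100$ nodes and no other singularities.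
   Context: Homogeneous coordinates on $\mathbb{P}^3$ are $(x:y:z:w)$. The singularities are counted geometrically, i.e. over an algebraic closure of $\mathbb{F}_5$ (not all of their coordinates lie in $\mathbb{F}_5$). A node (ordinary double point, $A_1$ singularity) is a singular point at which the Hessian of a local defining equation is nondegenerate. *)

theory Defs
  imports
    "HOL-Library.Poly_Mapping"
    "HOL-Algebra.Algebraic_Closure_Type"
    "Berlekamp_Zassenhaus.Finite_Field"
    "Jordan_Normal_Form.Determinant"
begin

section \<open>The field with five elements\<close>

text \<open>
  The type \<open>'a mod_ring\<close> is the ring of integers modulo \<open>CARD('a)\<close>, and a field if this
  cardinality is prime. The numeral type \<open>5\<close> is built from type constructors and
  cannot be made an instance of \<^class>\<open>prime_card\<close>, so an index type is introduced here.
\<close>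

typedef five = "{0..<5::nat}"
  by (rule exI[of _ 0]) simp

lemma CARD_five: "CARD(five) = 5"
  using type_definition.card[OF type_definition_five] by simp

instance five :: prime_card
  by standard (simp add: CARD_five)

type_synonym F5 = "five mod_ring"


section \<open>Polynomials in several variables\<close>

text \<open>A polynomial is a finitely supported map from exponent vectors to coefficients;
  the ring structure is the one of \<^type>\<open>poly_mapping\<close>.\<close>

type_synonym 'a mpoly = "(nat \<Rightarrow>\<^sub>0 nat) \<Rightarrow>\<^sub>0 'a"

definition mvar :: "nat \<Rightarrow> 'a::comm_ring_1 mpoly" where
  "mvar i = Poly_Mapping.single (Poly_Mapping.single i 1) 1"

definition mconst :: "'a::comm_ring_1 \<Rightarrow> 'a mpoly" where
  "mconst c = Poly_Mapping.single 0 c"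

text \<open>The coefficients are mapped by \<open>h\<close>: for \<open>h = id\<close> this is the value
  at the point \<open>v\<close>, for \<open>h = mconst\<close> the substitution of the polynomial
  \<open>v i\<close> for the \<open>i\<close>-th variable.\<close>

definition meval :: "('a::comm_ring_1 \<Rightarrow> 'b::comm_ring_1) \<Rightarrow> (nat \<Rightarrow> 'b) \<Rightarrow> 'a mpoly \<Rightarrow> 'b" where
  "meval h v f =
     (\<Sum>m\<in>Poly_Mapping.keys f.
        h (Poly_Mapping.lookup f m) *
        (\<Prod>i\<in>Poly_Mapping.keys m. v i ^ Poly_Mapping.lookup m i))"

text \<open>The subtraction of exponents is truncated, but where this matters the coefficient is 0.\<close>

definition mderiv :: "nat \<Rightarrow> 'a::comm_ring_1 mpoly \<Rightarrow> 'a mpoly" where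
  "mderiv i f =
     (\<Sum>m\<in>Poly_Mapping.keys f.
        Poly_Mapping.single (m - Poly_Mapping.single i 1)
          (of_nat (Poly_Mapping.lookup m i) * Poly_Mapping.lookup f m))"

definition homogeneous :: "nat \<Rightarrow> 'a::comm_ring_1 mpoly \<Rightarrow> bool" where
  "homogeneous d f \<longleftrightarrow>
     (\<forall>m\<in>Poly_Mapping.keys f. (\<Sum>i\<in>Poly_Mapping.keys m. Poly_Mapping.lookup m i) = d)"


section \<open>Surfaces in projective three-space\<close>

definition proj_rel :: "('k::field vec \<times> 'k vec) set" where
  "proj_rel =
     {(u, v). u \<in> carrier_vec 4 - {0\<^sub>v 4} \<and> v \<in> carrier_vec 4 - {0\<^sub>v 4} \<and>
              (\<exists>c. c \<noteq> 0 \<and> v = c \<cdot>\<^sub>v u)}"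

definition proj3 :: "'k::field vec set set" where
  "proj3 = (carrier_vec 4 - {0\<^sub>v 4}) // proj_rel"

text \<open>The variables \<open>0, 1, 2, 3\<close> are the homogeneous coordinates. The points are
  those over the field \<open>'k\<close> of coefficients.\<close>

definition surface :: "'k::field mpoly \<Rightarrow> 'k vec set set" where
  "surface F = {p \<in> proj3. \<forall>v\<in>p. meval id (\<lambda>i. v $ i) F = 0}"

definition singular_points :: "'k::field mpoly \<Rightarrow> 'k vec set set" where
  "singular_points F =
     {p \<in> surface F. \<forall>v\<in>p. \<forall>j<4. meval id (\<lambda>i. v $ i) (mderiv j F) = 0}"

text \<open>The affine chart in which the \<open>i\<close>-th homogeneous coordinate is 1 has the remaining
  coordinates, renumbered as \<open>0, 1, 2\<close>, as affine coordinates.\<close>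

definition local_equation :: "nat \<Rightarrow> 'k::field mpoly \<Rightarrow> 'k mpoly" where
  "local_equation i F =
     meval mconst (\<lambda>j. if j < i then mvar j else if j = i then 1 else mvar (j - 1)) F"

definition chart_coords :: "nat \<Rightarrow> 'k::field vec \<Rightarrow> nat \<Rightarrow> 'k" where
  "chart_coords i v j = v $ (if j < i then j else Suc j)"

definition hessian :: "'k::field mpoly \<Rightarrow> (nat \<Rightarrow> 'k) \<Rightarrow> 'k mat" where
  "hessian f q = mat 3 3 (\<lambda>(j, k). meval id q (mderiv j (mderiv k f)))"

text \<open>At a singular point, passing to another chart multiplies the determinant of the Hessian
  by a nonzero factor, so it is enough to ask for one chart.\<close>

definition is_node :: "'k::field mpoly \<Rightarrow> 'k vec set \<Rightarrow> bool" where
  "is_node F p \<longleftrightarrow>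
     p \<in> singular_points F \<and>
     (\<exists>i<4. \<exists>v\<in>p. v $ i = 1 \<and> det (hessian (local_equation i F) (chart_coords i v)) \<noteq> 0)"

text \<open>Extension of the coefficients to the algebraic closure\<close>

definition geometric :: "'k::field mpoly \<Rightarrow> 'k alg_closure mpoly" where
  "geometric F = Poly_Mapping.map to_ac F"


section \<open>The septic\<close>

definition septic_P :: "F5 mpoly" where
  "septic_P = (let x = mvar 0; y = mvar 1; z = mvar 2 in
     x * (x^6 - 3 * 7 * x^4 * y^2 + 5 * 7 * x^2 * y^4 - 7 * y^6)
     + 7 * z * ((x^2 + y^2)^3 - 2^3 * z^2 * (x^2 + y^2)^2 + 2^4 * z^4 * (x^2 + y^2))
     - 2^6 * z^7)"

definition septic_a1 :: "F5 \<Rightarrow> F5" where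
  "septic_a1 \<alpha> = - (12 / 7) * \<alpha>^2 - (384 / 49) * \<alpha> - 8 / 7"

definition septic_a2 :: "F5 \<Rightarrow> F5" where
  "septic_a2 \<alpha> = - (32 / 7) * \<alpha>^2 + (24 / 49) * \<alpha> - 4"

definition septic_a3 :: "F5 \<Rightarrow> F5" where
  "septic_a3 \<alpha> = - 4 * \<alpha>^2 + (24 / 49) * \<alpha> - 4"

definition septic_a4 :: "F5 \<Rightarrow> F5" where
  "septic_a4 \<alpha> = - (8 / 7) * \<alpha>^2 + (8 / 49) * \<alpha> - 8 / 7"

definition septic_a5 :: "F5 \<Rightarrow> F5" where
  "septic_a5 \<alpha> = 49 * \<alpha>^2 - 7 * \<alpha> + 50"

definition septic_U :: "F5 \<Rightarrow> F5 mpoly" where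
  "septic_U \<alpha> = (let x = mvar 0; y = mvar 1; z = mvar 2; w = mvar 3 in
     (z + mconst (septic_a5 \<alpha>) * w) *
     ((z + w) * (x^2 + y^2) + mconst (septic_a1 \<alpha>) * z^3 + mconst (septic_a2 \<alpha>) * z^2 * w
       + mconst (septic_a3 \<alpha>) * z * w^2 + mconst (septic_a4 \<alpha>) * w^3)^2)"

definition alpha5 :: F5 where
  "alpha5 = 1"

definition septic :: "F5 \<Rightarrow> F5 mpoly" where
  "septic \<alpha> = septic_P - septic_U \<alpha>"

end

theory Submission
  imports Defs
begin

text \<open>
  In \<open>F\<^sub>5\<close> the number 2 is a square root of \<open>- 1\<close>, so \<open>u = x + 2 y\<close> and \<open>v = x - 2 y\<close> play the
  roles of \<open>x + i y\<close> and \<open>x - i y\<close>. With \<open>t = u v = x\<^sup>2 + y\<^sup>2\<close> the septic becomes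
  \<open>3 (u^7 + v^7) + Phi t z w\<close> for a polynomial \<open>Phi\<close> (\<open>septic_eq_Psi\<close>). It is invariant under
  \<open>(u, v) \<mapsto> (\<omega> u, \<omega>\<^sup>-\<^sup>1 v)\<close> for \<open>\<omega>^7 = 1\<close>, and the partial derivatives vanish if and only if

    \<open>u^6 = - v Phi_t,   v^6 = - u Phi_t,   Phi_z = 0,   Phi_w = 0\<close>.

  If \<open>u v = 0\<close>, then \<open>u = v = 0\<close>, and exactly the two points \<open>(0:0:-1:1)\<close> and
  \<open>(0:0:1:0)\<close> of this axis satisfy the other equations. There is no further singular point at infinity
  (\<open>critical_at_infinity\<close>, \<open>critical_on_axis\<close>). For \<open>t = u v \<noteq> 0\<close> and \<open>w = 1\<close> the equations mean
  that \<open>(t, z)\<close> satisfies \<open>Phi_t\<^sup>2 = t^5\<close>, \<open>Phi_z = 0\<close>, \<open>Phi_w = 0\<close>, and that \<open>u^7 = - t Phi_t\<close>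
  and \<open>v = t / u\<close> (\<open>critical_off_axis\<close>). So each such pair \<open>(t, z)\<close>, called a profile node below,
  carries an orbit of seven singular points.

  The profile nodes can be found explicitly because \<open>Phi_w\<close> is a constant multiple of
  \<open>Q * (Q + (z + 2 w) Q_w)\<close>, where both factors are linear in \<open>t\<close>. On each factor \<open>t\<close> is a rational
  function of \<open>z\<close>, and \<open>Phi_z\<close> becomes a polynomial in \<open>z\<close> alone; up to factors that vanish only
  where \<open>t = 0\<close>, it has degree 9 for the first factor and degree 5 for the second. Both polynomials are
  separable and they are coprime, whence \<open>9 + 5 = 14\<close> profile nodes over an algebraic closure
  (\<open>card_profile_nodes\<close>) and \<open>2 + 7 * 14 = 100\<close> singular points. No root has to be known: separability,
  coprimality and every inequality needed at a root follow from Bezout identities over \<open>F\<^sub>5\<close>, whose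
  cofactors come from the extended Euclidean algorithm.

  Off the axis, the Hessian determinant in the chart \<open>w = 1\<close> reduces by the critical equations to
  \<open>t Phi_t (Phi_tt Phi_zz - Phi_tz\<^sup>2)\<close>, and the last factor is nonzero at every profile node by another
  Bezout identity. On the axis it is \<open>- Phi_t\<^sup>2 Phi_zz\<close>, respectively \<open>- Phi_t\<^sup>2 Phi_ww\<close>.
\<close>

section \<open>Polynomials in several variables\<close>

text \<open>Evaluation, differentiation and extension of coefficients are additive by the form of
  their definitions; this induction reduces their multiplicative properties to single terms.\<close>

lemma mpoly_induct [case_names single add]:
  fixes f :: "'a::comm_ring_1 mpoly"
  assumes single: "\<And>m c. P (Poly_Mapping.single m c)"
    and add: "\<And>f g. P f \<Longrightarrow> P g \<Longrightarrow> P (f + g)"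
  shows "P f"
proof -
  have "P (\<Sum>m\<in>A. Poly_Mapping.single m (Poly_Mapping.lookup f m))" if "finite A" for A
    using that
  proof induction
    case empty
    show ?case using single[of 0 0] by simp
  next
    case (insert m A)
    thus ?case using single add by simp
  qed
  note sum = this[OF finite_keys]
  have expand: "f = (\<Sum>m\<in>Poly_Mapping.keys f. Poly_Mapping.single m (Poly_Mapping.lookup f m))"
    by (rule poly_mapping_eqI)
      (auto simp: lookup_sum lookup_single when_def sum.delta in_keys_iff)
  show ?thesis by (subst expand) (rule sum)
qed

subsection \<open>Evaluation\<close>

definition monomial_value :: "(nat \<Rightarrow> 'b::comm_ring_1) \<Rightarrow> (nat \<Rightarrow>\<^sub>0 nat) \<Rightarrow> 'b" where
  "monomial_value v m = (\<Prod>i\<in>Poly_Mapping.keys m. v i ^ Poly_Mapping.lookup m i)"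

lemma monomial_value_superset:
  assumes "finite A" "Poly_Mapping.keys m \<subseteq> A"
  shows "monomial_value v m = (\<Prod>i\<in>A. v i ^ Poly_Mapping.lookup m i)"
  unfolding monomial_value_def using assms
  by (intro prod.mono_neutral_left) (auto simp: in_keys_iff)

lemma monomial_value_add: "monomial_value v (m + n) = monomial_value v m * monomial_value v n"
proof -
  let ?A = "Poly_Mapping.keys m \<union> Poly_Mapping.keys n"
  have "Poly_Mapping.keys (m + n) \<subseteq> ?A" by (rule Poly_Mapping.keys_add)
  thus ?thesis
    by (simp add: monomial_value_superset[of ?A] lookup_add power_add prod.distrib)
qed

lemma meval_add:
  assumes "comm_ring_hom h"
  shows "meval h v (f + g) = meval h v f + meval h v g"
proof -
  interpret comm_ring_hom h by fact
  show ?thesis unfolding meval_def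
    by (rule setsum_keys_plus_distrib) (simp_all add: hom_distribs algebra_simps)
qed

lemma meval_single:
  assumes "comm_ring_hom h"
  shows "meval h v (Poly_Mapping.single m c) = h c * monomial_value v m"
proof -
  interpret comm_ring_hom h by fact
  show ?thesis by (simp add: meval_def monomial_value_def)
qed

lemma meval_mult:
  assumes h: "comm_ring_hom h"
  shows "meval h v (f * g) = meval h v f * meval h v g"
proof -
  interpret comm_ring_hom h by fact
  show ?thesis
  proof (induction f rule: mpoly_induct)
    case (single m c)
    show ?case
      by (induction g rule: mpoly_induct)
        (simp_all add: h mult_single meval_single meval_add monomial_value_add hom_distribs
          algebra_simps)
  next
    case (add f1 f2)
    thus ?case by (simp add: distrib_right meval_add[OF h])
  qed
qed

lemma meval_comm_ring_hom:
  assumes h: "comm_ring_hom h"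
  shows "comm_ring_hom (meval h v)"
proof -
  interpret comm_ring_hom h by fact
  have "meval h v 1 = 1"
    using meval_single[OF h, of v 0 1] by (simp add: monomial_value_def)
  moreover have "meval h v 0 = 0" by (simp add: meval_def)
  ultimately show ?thesis
    by unfold_locales (simp_all add: h meval_add meval_mult)
qed

lemma meval_mvar:
  assumes "comm_ring_hom h"
  shows "meval h v (mvar i) = v i"
proof -
  interpret comm_ring_hom h by fact
  show ?thesis by (simp add: mvar_def meval_single[OF assms] monomial_value_def)
qed

lemma comm_ring_hom_mconst: "comm_ring_hom mconst"
  by unfold_locales (simp_all add: mconst_def single_add mult_single)

lemma comm_ring_hom_id: "comm_ring_hom id"
  by unfold_locales simp_all

lemmas meval_id_hom = meval_comm_ring_hom[OF comm_ring_hom_id]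

text \<open>Since extension of coefficients is a ring homomorphism, the septic over the algebraic
  closure is given by the same expression in the variables as the septic over the prime field.\<close>

lemma comm_ring_hom_geometric: "comm_ring_hom (geometric :: 'k::field mpoly \<Rightarrow> _)"
proof
  show geometric_add: "geometric (f + g) = geometric f + geometric g" for f g :: "'k mpoly"
    unfolding geometric_def
    by (rule poly_mapping_eqI) (simp add: Poly_Mapping.map.rep_eq lookup_add when_def del: to_ac_add,
         metis add_0 add.right_neutral to_ac_0 to_ac_add)
  show "geometric (f * g) = geometric f * geometric g" for f g :: "'k mpoly"
  proof (induction f rule: mpoly_induct)
    case (single m c)
    show ?case
      by (induction g rule: mpoly_induct)
        (simp_all add: mult_single geometric_add distrib_left,
          simp add: geometric_def mult_single)
  next
    case (add f1 f2)
    thus ?case by (simp add: distrib_right geometric_add)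
  qed
  show "geometric (1 :: 'k mpoly) = 1" "geometric (0 :: 'k mpoly) = 0"
    unfolding geometric_def by (simp_all flip: single_one add: poly_mapping_eqI Poly_Mapping.map.rep_eq)
qed

lemma geometric_mvar: "geometric (mvar i) = mvar i"
  by (simp add: geometric_def mvar_def)

subsection \<open>Partial derivatives\<close>

lemma mderiv_add: "mderiv i (f + g) = mderiv i f + mderiv i g"
  unfolding mderiv_def
  by (rule setsum_keys_plus_distrib) (simp_all add: distrib_left single_add)

lemma mderiv_single:
  "mderiv i (Poly_Mapping.single m c) =
     Poly_Mapping.single (m - Poly_Mapping.single i 1) (of_nat (Poly_Mapping.lookup m i) * c)"
  by (simp add: mderiv_def)

lemma mderiv_mult: "mderiv i (f * g) = mderiv i f * g + f * mderiv i g"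
proof (induction f rule: mpoly_induct)
  case (single m a)
  show ?case
  proof (induction g rule: mpoly_induct)
    case (single n b)
    let ?e = "Poly_Mapping.single i (1::nat)"
    \<comment> \<open>The truncated subtraction only spoils this when the variable does not occur in \<open>m\<close>, and then
      the coefficient of the derivative is zero.\<close>
    have shift: "(m - ?e) + n = (m + n) - ?e" if "Poly_Mapping.lookup m i \<noteq> 0"
      for m n :: "nat \<Rightarrow>\<^sub>0 nat"
      using that by (intro poly_mapping_eqI) (auto simp: lookup_add lookup_minus lookup_single when_def)
    have left: "mderiv i (Poly_Mapping.single m a) * Poly_Mapping.single n b =
        Poly_Mapping.single (m + n - ?e) (of_nat (Poly_Mapping.lookup m i) * (a * b))"
      by (cases "Poly_Mapping.lookup m i = 0") (simp_all add: mderiv_single mult_single shift mult.assoc del: One_nat_def)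
    have right: "Poly_Mapping.single m a * mderiv i (Poly_Mapping.single n b) =
        Poly_Mapping.single (m + n - ?e) (of_nat (Poly_Mapping.lookup n i) * (a * b))"
      using shift[of n m]
      by (cases "Poly_Mapping.lookup n i = 0")
        (simp_all add: mderiv_single mult_single add.commute mult.left_commute del: One_nat_def)
    show ?case
      by (simp add: left right del: One_nat_def)
        (simp add: mult_single mderiv_single lookup_add distrib_right flip: single_add del: One_nat_def)
  next
    case (add g1 g2)
    thus ?case by (simp add: distrib_left mderiv_add add_ac)
  qed
next
  case (add f1 f2)
  thus ?case by (simp add: distrib_right mderiv_add add_ac)
qed

lemma mderiv_0: "mderiv i 0 = 0"
  by (simp add: mderiv_def)

lemma mderiv_1: "mderiv i 1 = 0"
  using mderiv_single[of i 0 1] by simp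

lemma mderiv_numeral: "mderiv i (numeral k) = 0"
  using mderiv_single[of i 0 "numeral k"] by simp

lemma mderiv_mconst: "mderiv i (mconst c) = 0"
  using mderiv_single[of i 0 c] by (simp add: mconst_def)

lemma mderiv_uminus: "mderiv i (- f) = - mderiv i f"
  using mderiv_add[of i f "- f"] by (simp add: mderiv_0 eq_neg_iff_add_eq_0 add.commute)

lemma mderiv_diff: "mderiv i (f - g) = mderiv i f - mderiv i g"
  using mderiv_add[of i f "- g"] by (simp add: mderiv_uminus)

lemma mderiv_power: "mderiv i (f ^ n) = of_nat n * f ^ (n - 1) * mderiv i f"
proof (induction n)
  case (Suc n)
  thus ?case by (cases n) (simp_all add: mderiv_mult algebra_simps)
qed (simp add: mderiv_1)

lemma mderiv_mvar: "mderiv i (mvar j) = (if i = j then 1 else 0)"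
  by (simp add: mvar_def mderiv_single lookup_single)

subsection \<open>Homogeneous polynomials\<close>

abbreviation monomial_degree :: "(nat \<Rightarrow>\<^sub>0 nat) \<Rightarrow> nat" where
  "monomial_degree m \<equiv> \<Sum>i\<in>Poly_Mapping.keys m. Poly_Mapping.lookup m i"

lemma monomial_degree_add: "monomial_degree (m + n) = monomial_degree m + monomial_degree n"
  by (rule setsum_keys_plus_distrib[where f = "\<lambda>_ k. k"]) simp_all

text \<open>The degrees appear as separate variables with an equation between them, so that the
  degree of an expression is computed by resolution from the degrees of its parts.\<close>

lemma homogeneous_add:
  "homogeneous d f \<Longrightarrow> homogeneous e g \<Longrightarrow> d = e \<Longrightarrow> homogeneous d (f + g)"
  using Poly_Mapping.keys_add[of f g] by (auto simp: homogeneous_def)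

lemma homogeneous_diff:
  "homogeneous d f \<Longrightarrow> homogeneous e g \<Longrightarrow> d = e \<Longrightarrow> homogeneous d (f - g)"
  for f g :: "'a::comm_ring_1 mpoly"
  by (auto simp: homogeneous_def in_keys_iff lookup_minus)

lemma homogeneous_mult:
  "homogeneous d f \<Longrightarrow> homogeneous e g \<Longrightarrow> homogeneous (d + e) (f * g)"
  using keys_mult[of f g] by (fastforce simp: homogeneous_def monomial_degree_add)

lemma homogeneous_mvar: "homogeneous 1 (mvar i)"
  by (simp add: homogeneous_def mvar_def)

lemma homogeneous_numeral: "homogeneous 0 (numeral k :: 'a::comm_ring_1 mpoly)"
proof -
  have "Poly_Mapping.keys (numeral k :: 'a::comm_ring_1 mpoly) \<subseteq> {0}"
    by (subst single_numeral[symmetric], subst keys_single) auto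
  thus ?thesis by (auto simp: homogeneous_def)
qed

lemma homogeneous_power: "homogeneous d f \<Longrightarrow> homogeneous (n * d) (f ^ n)"
proof (induction n)
  case 0
  thus ?case by (simp add: homogeneous_def)
next
  case (Suc n)
  thus ?case using homogeneous_mult[of d f "n * d" "f ^ n"] by simp
qed

section \<open>Singular points of a projective surface\<close>

text \<open>The conditions on representatives, without the passage to classes: counting singular points
  then amounts to choosing one vector on each line of solutions.\<close>

definition singular_vectors :: "'k::field mpoly \<Rightarrow> 'k vec set" where
  "singular_vectors F =
     {v \<in> carrier_vec 4 - {0\<^sub>v 4}. meval id (\<lambda>i. v $ i) F = 0 \<and>
        (\<forall>j<4. meval id (\<lambda>i. v $ i) (mderiv j F) = 0)}"

lemma equiv_proj_rel: "equiv (carrier_vec 4 - {0\<^sub>v 4}) (proj_rel :: ('k::field vec \<times> 'k vec) set)"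
proof (rule equivI)
  show "(proj_rel :: ('k vec \<times> 'k vec) set) \<subseteq>
      (carrier_vec 4 - {0\<^sub>v 4}) \<times> (carrier_vec 4 - {0\<^sub>v 4})"
    by (auto simp: proj_rel_def)
  show "refl_on (carrier_vec 4 - {0\<^sub>v 4}) (proj_rel :: ('k vec \<times> 'k vec) set)"
    by (rule refl_onI) (auto simp: proj_rel_def intro!: exI[of _ 1])
  show "sym (proj_rel :: ('k vec \<times> 'k vec) set)"
  proof (rule symI)
    fix u v :: "'k vec"
    assume uv: "(u, v) \<in> proj_rel"
    then obtain c where c: "c \<noteq> 0" "v = c \<cdot>\<^sub>v u" by (auto simp: proj_rel_def)
    hence "u = inverse c \<cdot>\<^sub>v v" by (simp add: smult_smult_assoc)
    moreover have "inverse c \<noteq> 0" using c by simp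
    ultimately have "\<exists>c. c \<noteq> 0 \<and> u = c \<cdot>\<^sub>v v" by blast
    thus "(v, u) \<in> proj_rel" using uv unfolding proj_rel_def by simp
  qed
  show "trans (proj_rel :: ('k vec \<times> 'k vec) set)"
  proof (rule transI)
    fix u v w :: "'k vec"
    assume uv: "(u, v) \<in> proj_rel" and vw: "(v, w) \<in> proj_rel"
    then obtain c d where "c \<noteq> 0" "v = c \<cdot>\<^sub>v u" "d \<noteq> 0" "w = d \<cdot>\<^sub>v v"
      by (auto simp: proj_rel_def)
    hence "d * c \<noteq> 0 \<and> w = (d * c) \<cdot>\<^sub>v u" by (simp add: smult_smult_assoc)
    hence "\<exists>c. c \<noteq> 0 \<and> w = c \<cdot>\<^sub>v u" by blast
    thus "(u, w) \<in> proj_rel" using uv vw unfolding proj_rel_def by simp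
  qed
qed

lemma in_proj_class_iff:
  assumes "v \<in> carrier_vec 4 - {0\<^sub>v 4}"
  shows "u \<in> proj_rel `` {v} \<longleftrightarrow> (\<exists>c. c \<noteq> 0 \<and> u = c \<cdot>\<^sub>v v)"
proof -
  have "c \<cdot>\<^sub>v v \<noteq> 0\<^sub>v 4" if "c \<noteq> 0" for c
  proof
    assume "c \<cdot>\<^sub>v v = 0\<^sub>v 4"
    hence "inverse c \<cdot>\<^sub>v (c \<cdot>\<^sub>v v) = 0\<^sub>v 4" by (simp only:) (rule eq_vecI; simp)
    moreover have "inverse c \<cdot>\<^sub>v (c \<cdot>\<^sub>v v) = v" using that by (simp add: smult_smult_assoc)
    ultimately show False using assms by simp
  qed
  thus ?thesis using assms by (auto simp: proj_rel_def)
qed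

text \<open>A class of vectors is singular if all of its members are; closure under scaling makes a
  single member enough.\<close>

lemma singular_points_eq_image:
  assumes scale: "\<And>c v. v \<in> singular_vectors F \<Longrightarrow> c \<noteq> 0 \<Longrightarrow> c \<cdot>\<^sub>v v \<in> singular_vectors F"
  shows "singular_points F = (\<lambda>v. proj_rel `` {v}) ` singular_vectors F"
proof (intro equalityI subsetI)
  fix p assume p: "p \<in> singular_points F"
  hence "p \<in> (carrier_vec 4 - {0\<^sub>v 4}) // proj_rel"
    by (simp add: singular_points_def surface_def proj3_def)
  then obtain v where v: "v \<in> carrier_vec 4 - {0\<^sub>v 4}" "p = proj_rel `` {v}"
    by (rule quotientE)
  have "v \<in> p" using v equiv_class_self[OF equiv_proj_rel] by blast
  hence "v \<in> singular_vectors F"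
    using p v by (auto simp: singular_vectors_def singular_points_def surface_def)
  thus "p \<in> (\<lambda>v. proj_rel `` {v}) ` singular_vectors F" using v by blast
next
  fix p assume "p \<in> (\<lambda>v. proj_rel `` {v}) ` singular_vectors F"
  then obtain v where v: "v \<in> singular_vectors F" and p: "p = proj_rel `` {v}" by blast
  have v4: "v \<in> carrier_vec 4 - {0\<^sub>v 4}" using v by (simp add: singular_vectors_def)
  have "u \<in> singular_vectors F" if "u \<in> p" for u
    using that scale[OF v] unfolding p in_proj_class_iff[OF v4] by blast
  moreover have "p \<in> proj3" unfolding proj3_def p using v4 by (rule quotientI)
  ultimately show "p \<in> singular_points F"
    by (auto simp: singular_vectors_def singular_points_def surface_def)
qed

lemma bij_betw_singular_points:
  assumes scale: "\<And>c v. v \<in> singular_vectors F \<Longrightarrow> c \<noteq> 0 \<Longrightarrow> c \<cdot>\<^sub>v v \<in> singular_vectors F"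
    and R: "R \<subseteq> singular_vectors F"
    and cover: "\<And>v. v \<in> singular_vectors F \<Longrightarrow> \<exists>c. c \<noteq> 0 \<and> c \<cdot>\<^sub>v v \<in> R"
    and unique: "\<And>c r. r \<in> R \<Longrightarrow> c \<noteq> 0 \<Longrightarrow> c \<cdot>\<^sub>v r \<in> R \<Longrightarrow> c \<cdot>\<^sub>v r = r"
  shows "bij_betw (\<lambda>v. proj_rel `` {v}) R (singular_points F)"
proof -
  have carrier: "v \<in> carrier_vec 4 - {0\<^sub>v 4}" if "v \<in> singular_vectors F" for v
    using that by (simp add: singular_vectors_def)
  have "inj_on (\<lambda>v. proj_rel `` {v}) R"
  proof (rule inj_onI)
    fix r s assume rs: "r \<in> R" "s \<in> R" "proj_rel `` {r} = proj_rel `` {s}"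
    have "s \<in> proj_rel `` {r}"
      using rs R carrier equiv_class_self[OF equiv_proj_rel] by blast
    then obtain c where "c \<noteq> 0" "s = c \<cdot>\<^sub>v r"
      using rs R carrier in_proj_class_iff by blast
    thus "r = s" using unique rs by metis
  qed
  moreover have "(\<lambda>v. proj_rel `` {v}) ` singular_vectors F \<subseteq> (\<lambda>v. proj_rel `` {v}) ` R"
  proof
    fix p assume "p \<in> (\<lambda>v. proj_rel `` {v}) ` singular_vectors F"
    then obtain v where v: "v \<in> singular_vectors F" "p = proj_rel `` {v}" by blast
    then obtain c where c: "c \<noteq> 0" "c \<cdot>\<^sub>v v \<in> R" using cover by blast
    have "c \<cdot>\<^sub>v v \<in> proj_rel `` {v}"
      using c v carrier in_proj_class_iff by blast
    hence "proj_rel `` {v} = proj_rel `` {c \<cdot>\<^sub>v v}"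
      by (intro equiv_class_eq[OF equiv_proj_rel]) simp
    thus "p \<in> (\<lambda>v. proj_rel `` {v}) ` R" using c v by blast
  qed
  ultimately show ?thesis
    using R by (auto simp: bij_betw_def singular_points_eq_image[OF scale])
qed

section \<open>Determinants of order three\<close>

lemma det_3:
  fixes f :: "nat \<Rightarrow> nat \<Rightarrow> 'a::comm_ring_1"
  shows "det (mat 3 3 (\<lambda>(i, j). f i j)) =
     f 0 0 * (f 1 1 * f 2 2 - f 1 2 * f 2 1)
     - f 0 1 * (f 1 0 * f 2 2 - f 1 2 * f 2 0)
     + f 0 2 * (f 1 0 * f 2 1 - f 1 1 * f 2 0)"
proof -
  have det2: "det (mat 2 2 g) = g (0, 0) * g (1, 1) - g (0, 1) * g (1, 0)" for g :: "_ \<Rightarrow> 'a"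
  proof -
    have minor: "mat_delete (mat 2 2 g) 0 k = mat 1 1 (\<lambda>_. g (1, 1 - k))" if "k < 2" for k
      by (rule eq_matI) (use that in \<open>auto simp: mat_delete_def less_2_cases_iff\<close>)
    have "det (mat 2 2 g) = (\<Sum>k<2. mat 2 2 g $$ (0, k) * cofactor (mat 2 2 g) 0 k)"
      by (rule laplace_expansion_row) auto
    also have "{..<2::nat} = {0, 1}" by auto
    finally show ?thesis by (simp add: cofactor_def minor det_single)
  qed
  let ?M = "mat 3 3 (\<lambda>(i, j). f i j)"
  have minor: "mat_delete ?M 0 k = mat 2 2 (\<lambda>(i, j). f (Suc i) (if j < k then j else Suc j))"
    if "k < 3" for k
    by (rule eq_matI) (use that in \<open>auto simp: mat_delete_def\<close>)
  have "det ?M = (\<Sum>k<3. ?M $$ (0, k) * cofactor ?M 0 k)"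
    by (rule laplace_expansion_row) auto
  also have "{..<3::nat} = {0, 1, 2}" by auto
  finally show ?thesis
    by (simp add: cofactor_def minor det2) (simp add: numeral_2_eq_2 algebra_simps)
qed

section \<open>Counting roots\<close>

text \<open>Over an algebraically closed field linear factors split off one after the other; a root in
  common with the derivative is the only way in which a root could be counted twice.\<close>

lemma card_roots_separable:
  fixes p :: "'a::alg_closed_field poly"
  assumes "\<And>x. poly p x = 0 \<Longrightarrow> poly (pderiv p) x \<noteq> 0"
  shows "card {x. poly p x = 0} = degree p"
  using assms
proof (induction "degree p" arbitrary: p)
  case 0
  then obtain c where c: "p = [:c:]" by (metis degree_eq_zeroE)
  have "c \<noteq> 0" using "0.prems"[of 0] by (auto simp: c pderiv_pCons)
  thus ?case by (simp add: c)
next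
  case (Suc n)
  then obtain a where a: "poly p a = 0"
    using alg_closed_imp_poly_has_root[of p] by auto
  then obtain q where p: "p = [:-a, 1:] * q" by (metis dvdE poly_eq_0_iff_dvd)
  have "q \<noteq> 0" using Suc.hyps p by auto
  hence deg: "degree p = Suc (degree q)" unfolding p by (subst degree_mult_eq) auto
  have "pderiv p = [:-a, 1:] * pderiv q + q * pderiv [:-a, 1:]"
    unfolding p by (rule pderiv_mult)
  hence pd: "poly (pderiv p) x = (x - a) * poly (pderiv q) x + poly q x" for x
    by (simp add: pderiv_pCons del: mult_pCons_left)
  have "poly q x = 0 \<Longrightarrow> poly (pderiv q) x \<noteq> 0" for x
    using Suc.prems[of x] pd[of x] by (auto simp: p)
  hence card: "card {x. poly q x = 0} = degree q" using Suc.hyps deg by simp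
  have "poly q a \<noteq> 0" using Suc.prems[OF a] by (simp add: pd)
  moreover have "{x. poly p x = 0} = insert a {x. poly q x = 0}"
    by (auto simp: p)
  ultimately show ?case
    using card deg \<open>q \<noteq> 0\<close> by (simp add: poly_roots_finite)
qed

lemma card_nth_roots:
  fixes c :: "'a::alg_closed_field"
  assumes "of_nat n \<noteq> (0::'a)" "c \<noteq> 0"
  shows "card {x. x ^ n = c} = n"
proof -
  let ?p = "monom 1 n + [:- c:]"
  have n: "n > 0" using assms(1) by (cases n) auto
  have "poly ?p x = 0 \<Longrightarrow> poly (pderiv ?p) x \<noteq> 0" for x
    using assms n by (auto simp: pderiv_add pderiv_monom poly_monom pderiv_pCons)
  hence "card {x. poly ?p x = 0} = degree ?p" by (rule card_roots_separable)
  moreover have "degree ?p = n"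
    using n by (subst degree_add_eq_left) (simp_all add: degree_monom_eq)
  ultimately show ?thesis by (simp add: poly_monom)
qed

section \<open>Arithmetic in characteristic five\<close>

text \<open>Every numeral equals one of \<open>- 2, - 1, 0, 1, 2\<close> in characteristic five. Used as rewrite rules,
  the equations replace the leading part \<open>4 n\<close> of a binary numeral by \<open>- n\<close>. An identity between
  polynomial expressions that holds modulo 5 is therefore proved by expanding both sides over the
  integers and then reducing the coefficients.\<close>

lemma numeral_mod5:
  assumes five: "(5::'a::comm_ring_1) = 0"
  shows "numeral (num.Bit0 (num.Bit0 n)) = - (numeral n :: 'a)"
    "numeral (num.Bit1 (num.Bit0 n)) = 1 - (numeral n :: 'a)"
    "numeral (num.Bit0 (num.Bit1 n)) = 2 - (numeral n :: 'a)"
    "numeral (num.Bit1 (num.Bit1 n)) = - 2 - (numeral n :: 'a)"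
    "(3::'a) = - 2"
proof -
  have 5: "(1::'a) + 1 + 1 + 1 + 1 = 0" using five by simp
  have *: "x + x + x + x = - x" for x :: 'a
  proof -
    have "x + x + x + x + x = (1 + 1 + 1 + 1 + 1) * x" by (simp only: ring_distribs mult_1)
    also have "\<dots> = 0" by (simp only: 5 mult_zero_left)
    finally show ?thesis by (simp only: eq_neg_iff_add_eq_0)
  qed
  define k where "k = (numeral n :: 'a)"
  have 4: "k + k + (k + k) = - k" using *[of k] by (simp only: add.assoc)
  show "numeral (num.Bit0 (num.Bit0 n)) = - (numeral n :: 'a)"
    by (simp only: numeral_Bit0 flip: k_def) (rule 4)
  show "numeral (num.Bit1 (num.Bit0 n)) = 1 - (numeral n :: 'a)"
    by (simp only: numeral_Bit0 numeral_Bit1 4 flip: k_def) simp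
  show "numeral (num.Bit0 (num.Bit1 n)) = 2 - (numeral n :: 'a)"
  proof -
    have "k + k + 1 + (k + k + 1) = (k + k + (k + k)) + 2" by simp
    thus ?thesis by (simp only: numeral_Bit0 numeral_Bit1 4 flip: k_def) simp
  qed
  show 3: "(3::'a) = - 2" using five by (simp add: eq_neg_iff_add_eq_0)
  show "numeral (num.Bit1 (num.Bit1 n)) = - 2 - (numeral n :: 'a)"
  proof -
    have "k + k + 1 + (k + k + 1) + 1 = (k + k + (k + k)) + 3" by simp
    hence "k + k + 1 + (k + k + 1) + 1 = - 2 - k"
      by (simp only: 4 3 diff_conv_add_uminus add.commute)
    thus ?thesis by (simp only: numeral_Bit1 flip: k_def)
  qed
qed

lemma two_nonzero_mod5:
  assumes "(5::'a::{comm_ring_1,zero_neq_one}) = 0"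
  shows "(2::'a) \<noteq> 0"
proof
  assume "(2::'a) = 0"
  moreover have "(5::'a) = 2 + 2 + 1" by simp
  ultimately show False using assms by simp
qed

lemma five_F5: "(5 :: F5) = 0"
proof -
  have "(of_nat CARD(five) :: F5) = 0" by (rule of_nat_card_eq_0)
  thus ?thesis by (simp add: CARD_five)
qed

lemma five_ac: "(5 :: F5 alg_closure) = 0"
  using arg_cong[OF five_F5, of to_ac] by simp

lemma mconst_numeral: "mconst (numeral k) = numeral k"
  by (simp add: mconst_def)

lemma five_mpoly: "(5 :: F5 mpoly) = 0"
  using arg_cong[OF five_F5, of mconst] by (simp only: mconst_numeral) (simp add: mconst_def)

section \<open>The septic in coordinates adapted to its symmetry\<close>

text \<open>\<open>Q\<close> is the factor of \<open>U\<close> that occurs squared, for \<open>\<alpha> = 1\<close> and with \<open>t\<close> in place of \<open>x\<^sup>2 + y\<^sup>2\<close>.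
  The definitions of the derivatives keep the exact integer coefficients of formal differentiation, so
  that the chain rules below hold over every commutative ring.\<close>

definition Q :: "'a::comm_ring_1 \<Rightarrow> 'a \<Rightarrow> 'a \<Rightarrow> 'a" where
  "Q t z w = (z + w) * t + 4 * z^3 + z^2 * w + 3 * z * w^2 + 4 * w^3"
definition Q_z :: "'a::comm_ring_1 \<Rightarrow> 'a \<Rightarrow> 'a \<Rightarrow> 'a" where
  "Q_z t z w = t + 12 * z^2 + 2 * z * w + 3 * w^2"
definition Q_w :: "'a::comm_ring_1 \<Rightarrow> 'a \<Rightarrow> 'a \<Rightarrow> 'a" where
  "Q_w t z w = t + z^2 + 6 * z * w + 12 * w^2"

text \<open>\<open>Phi\<close> collects the part of the septic that depends on \<open>x\<close> and \<open>y\<close> through \<open>t = x\<^sup>2 + y\<^sup>2\<close> only: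
  the summands of \<open>P\<close> that contain \<open>z\<close>, with coefficients reduced modulo 5, minus \<open>U\<close>.\<close>

definition Phi :: "'a::comm_ring_1 \<Rightarrow> 'a \<Rightarrow> 'a \<Rightarrow> 'a" where
  "Phi t z w = 2 * z * t^3 - z^3 * t^2 + 2 * z^5 * t + z^7 - (z + 2 * w) * (Q t z w)^2"
definition Phi_t :: "'a::comm_ring_1 \<Rightarrow> 'a \<Rightarrow> 'a \<Rightarrow> 'a" where
  "Phi_t t z w = 6 * z * t^2 - 2 * z^3 * t + 2 * z^5 - 2 * (z + 2 * w) * (z + w) * Q t z w"
definition Phi_z :: "'a::comm_ring_1 \<Rightarrow> 'a \<Rightarrow> 'a \<Rightarrow> 'a" where
  "Phi_z t z w = 2 * t^3 - 3 * z^2 * t^2 + 10 * z^4 * t + 7 * z^6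
     - (Q t z w)^2 - 2 * (z + 2 * w) * Q t z w * Q_z t z w"
definition Phi_w :: "'a::comm_ring_1 \<Rightarrow> 'a \<Rightarrow> 'a \<Rightarrow> 'a" where
  "Phi_w t z w = - 2 * Q t z w * (Q t z w + (z + 2 * w) * Q_w t z w)"
definition Phi_tt :: "'a::comm_ring_1 \<Rightarrow> 'a \<Rightarrow> 'a \<Rightarrow> 'a" where
  "Phi_tt t z w = 12 * z * t - 2 * z^3 - 2 * (z + 2 * w) * (z + w)^2"
definition Phi_tz :: "'a::comm_ring_1 \<Rightarrow> 'a \<Rightarrow> 'a \<Rightarrow> 'a" where
  "Phi_tz t z w = 6 * t^2 - 6 * z^2 * t + 10 * z^4
     - 2 * (2 * z + 3 * w) * Q t z w - 2 * (z + 2 * w) * (z + w) * Q_z t z w"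
definition Phi_tw :: "'a::comm_ring_1 \<Rightarrow> 'a \<Rightarrow> 'a \<Rightarrow> 'a" where
  "Phi_tw t z w = - 2 * (3 * z + 4 * w) * Q t z w - 2 * (z + 2 * w) * (z + w) * Q_w t z w"
definition Phi_zz :: "'a::comm_ring_1 \<Rightarrow> 'a \<Rightarrow> 'a \<Rightarrow> 'a" where
  "Phi_zz t z w = - 6 * z * t^2 + 40 * z^3 * t + 42 * z^5 - 4 * Q t z w * Q_z t z w
     - 2 * (z + 2 * w) * ((Q_z t z w)^2 + Q t z w * (24 * z + 2 * w))"
definition Phi_zw :: "'a::comm_ring_1 \<Rightarrow> 'a \<Rightarrow> 'a \<Rightarrow> 'a" where
  "Phi_zw t z w = - 2 * Q t z w * Q_w t z w - 4 * Q t z w * Q_z t z w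
     - 2 * (z + 2 * w) * (Q_w t z w * Q_z t z w + Q t z w * (2 * z + 6 * w))"
definition Phi_ww :: "'a::comm_ring_1 \<Rightarrow> 'a \<Rightarrow> 'a \<Rightarrow> 'a" where
  "Phi_ww t z w = - 2 * Q_w t z w * (Q t z w + (z + 2 * w) * Q_w t z w)
     - 2 * Q t z w * (3 * Q_w t z w + (z + 2 * w) * (6 * z + 24 * w))"

lemmas Q_defs = Q_def Q_z_def Q_w_def
lemmas Phi_derivative_defs =
  Phi_t_def Phi_z_def Phi_w_def Phi_tt_def Phi_tz_def Phi_tw_def Phi_zz_def Phi_zw_def Phi_ww_def

text \<open>The septic in the coordinates \<open>u, v\<close>. In characteristic zero the coefficient 3 would be
  \<open>1/2\<close>, since \<open>P\<close> contains the real part of \<open>(x + i y)^7\<close>.\<close>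

definition Psi :: "'a::comm_ring_1 \<Rightarrow> 'a \<Rightarrow> 'a \<Rightarrow> 'a \<Rightarrow> 'a" where
  "Psi u v z w = 3 * (u^7 + v^7) + Phi (u * v) z w"

lemmas mderiv_simps = mderiv_add mderiv_diff mderiv_uminus mderiv_mult mderiv_power
  mderiv_0 mderiv_1 mderiv_numeral

lemma mderiv_Q:
  "mderiv i (Q t z w) = (z + w) * mderiv i t + Q_z t z w * mderiv i z + Q_w t z w * mderiv i w"
  by (simp add: Q_defs mderiv_simps algebra_simps power2_eq_square)

lemma mderiv_Q_z:
  "mderiv i (Q_z t z w) = mderiv i t + (24 * z + 2 * w) * mderiv i z + (2 * z + 6 * w) * mderiv i w"
  by (simp add: Q_defs mderiv_simps algebra_simps power2_eq_square)

lemma mderiv_Q_w: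
  "mderiv i (Q_w t z w) = mderiv i t + (2 * z + 6 * w) * mderiv i z + (6 * z + 24 * w) * mderiv i w"
  by (simp add: Q_defs mderiv_simps algebra_simps power2_eq_square)

lemma mderiv_Phi:
  "mderiv i (Phi t z w) =
     Phi_t t z w * mderiv i t + Phi_z t z w * mderiv i z + Phi_w t z w * mderiv i w"
  by (simp add: Phi_def Phi_derivative_defs mderiv_simps mderiv_Q algebra_simps numeral_eq_Suc)

lemma mderiv_Phi_t:
  "mderiv i (Phi_t t z w) =
     Phi_tt t z w * mderiv i t + Phi_tz t z w * mderiv i z + Phi_tw t z w * mderiv i w"
  by (simp add: Phi_derivative_defs mderiv_simps mderiv_Q algebra_simps numeral_eq_Suc)

lemma mderiv_Phi_z:
  "mderiv i (Phi_z t z w) =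
     Phi_tz t z w * mderiv i t + Phi_zz t z w * mderiv i z + Phi_zw t z w * mderiv i w"
  by (simp add: Phi_derivative_defs mderiv_simps mderiv_Q mderiv_Q_z algebra_simps numeral_eq_Suc)

lemma mderiv_Phi_w:
  "mderiv i (Phi_w t z w) =
     Phi_tw t z w * mderiv i t + Phi_zw t z w * mderiv i z + Phi_ww t z w * mderiv i w"
  by (simp add: Phi_derivative_defs mderiv_simps mderiv_Q mderiv_Q_w algebra_simps numeral_eq_Suc)

lemma mderiv_Psi:
  "mderiv i (Psi u v z w) =
     (21 * u^6 + v * Phi_t (u * v) z w) * mderiv i u + (21 * v^6 + u * Phi_t (u * v) z w) * mderiv i v
     + Phi_z (u * v) z w * mderiv i z + Phi_w (u * v) z w * mderiv i w"
  by (simp add: Psi_def mderiv_Phi mderiv_simps algebra_simps)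

lemma comm_ring_hom_Psi:
  assumes "comm_ring_hom h"
  shows "h (Psi u v z w) = Psi (h u) (h v) (h z) (h w)"
proof -
  interpret comm_ring_hom h by fact
  show ?thesis by (simp add: Psi_def Phi_def Q_def hom_distribs)
qed

lemma comm_ring_hom_Phi_derivatives:
  assumes "comm_ring_hom h"
  shows "h (Phi_t t z w) = Phi_t (h t) (h z) (h w)" "h (Phi_z t z w) = Phi_z (h t) (h z) (h w)"
    "h (Phi_w t z w) = Phi_w (h t) (h z) (h w)" "h (Phi_tt t z w) = Phi_tt (h t) (h z) (h w)"
    "h (Phi_tz t z w) = Phi_tz (h t) (h z) (h w)" "h (Phi_tw t z w) = Phi_tw (h t) (h z) (h w)"
    "h (Phi_zz t z w) = Phi_zz (h t) (h z) (h w)" "h (Phi_zw t z w) = Phi_zw (h t) (h z) (h w)"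
    "h (Phi_ww t z w) = Phi_ww (h t) (h z) (h w)"
proof -
  interpret comm_ring_hom h by fact
  show "h (Phi_t t z w) = Phi_t (h t) (h z) (h w)" "h (Phi_z t z w) = Phi_z (h t) (h z) (h w)"
    "h (Phi_w t z w) = Phi_w (h t) (h z) (h w)" "h (Phi_tt t z w) = Phi_tt (h t) (h z) (h w)"
    "h (Phi_tz t z w) = Phi_tz (h t) (h z) (h w)" "h (Phi_tw t z w) = Phi_tw (h t) (h z) (h w)"
    "h (Phi_zz t z w) = Phi_zz (h t) (h z) (h w)" "h (Phi_zw t z w) = Phi_zw (h t) (h z) (h w)"
    "h (Phi_ww t z w) = Phi_ww (h t) (h z) (h w)"
    by (simp_all add: Phi_derivative_defs Q_defs hom_distribs)
qed

lemma septic_coefficients: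
  "septic_a1 alpha5 = 4" "septic_a2 alpha5 = 1" "septic_a3 alpha5 = 3" "septic_a4 alpha5 = 4"
  "septic_a5 alpha5 = 2"
  by (simp_all add: septic_a1_def septic_a2_def septic_a3_def septic_a4_def septic_a5_def
      alpha5_def numeral_mod5[OF five_F5] two_nonzero_mod5[OF five_F5])

text \<open>This is \<open>Re ((x + i y)^7) = (u^7 + v^7) / 2\<close> with \<open>i = 2\<close> and \<open>1/2 = 3\<close>.\<close>

lemma sum_of_seventh_powers_mod5:
  fixes x y :: "'a::comm_ring_1"
  assumes five: "(5::'a) = 0"
  shows "3 * ((x + 2 * y)^7 + (x - 2 * y)^7) =
    x * (x^6 - 3 * 7 * x^4 * y^2 + 5 * 7 * x^2 * y^4 - 7 * y^6)"
  by (simp add: numeral_eq_Suc algebra_simps) (simp add: numeral_mod5[OF five])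

lemma septic_eq_Psi:
  "septic alpha5 = Psi (mvar 0 + 2 * mvar 1) (mvar 0 - 2 * mvar 1) (mvar 2) (mvar 3)"
proof -
  have r: "((x + 2 * y) * (x - 2 * y) :: F5 mpoly) = x^2 + y^2" for x y
    by (simp add: algebra_simps power2_eq_square numeral_mod5[OF five_mpoly])
  have c: "septic_P = x * (x^6 - 3 * 7 * x^4 * y^2 + 5 * 7 * x^2 * y^4 - 7 * y^6) + R"
    if "x = mvar 0" "y = mvar 1" "R = 7 * mvar 2 * ((x^2 + y^2)^3 - 2^3 * mvar 2^2 * (x^2 + y^2)^2
      + 2^4 * mvar 2^4 * (x^2 + y^2)) - 2^6 * mvar 2^7"
    for x y R
    using that by (simp add: septic_P_def Let_def)
  show ?thesis
    unfolding septic_def c[OF refl refl refl] septic_U_def Let_def septic_coefficients mconst_numeral Psi_def Phi_def Q_def r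
      sum_of_seventh_powers_mod5[OF five_mpoly]
    by (simp add: mconst_def numeral_mod5[OF five_mpoly] algebra_simps numeral_eq_Suc)
qed

lemma geometric_septic_eq_Psi:
  "geometric (septic alpha5) = Psi (mvar 0 + 2 * mvar 1) (mvar 0 - 2 * mvar 1) (mvar 2) (mvar 3)"
proof -
  interpret comm_ring_hom "geometric :: F5 mpoly \<Rightarrow> _" by (rule comm_ring_hom_geometric)
  show ?thesis
    by (simp add: septic_eq_Psi comm_ring_hom_Psi[OF comm_ring_hom_geometric] hom_distribs geometric_mvar)
qed

section \<open>The critical equations\<close>

text \<open>The four equations are the partial derivatives of \<open>Psi\<close> with respect to \<open>u, v, z, w\<close>, with the
  coefficient \<open>3 * 7 = 21\<close> of \<open>u^6\<close> and \<open>v^6\<close> reduced to 1.\<close>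

definition critical :: "'a::comm_ring_1 \<Rightarrow> 'a \<Rightarrow> 'a \<Rightarrow> 'a \<Rightarrow> bool" where
  "critical u v z w \<longleftrightarrow>
     u^6 + v * Phi_t (u * v) z w = 0 \<and> v^6 + u * Phi_t (u * v) z w = 0 \<and>
     Phi_z (u * v) z w = 0 \<and> Phi_w (u * v) z w = 0"

text \<open>Homogeneity: \<open>t\<close> has weight 2, the coordinates \<open>z\<close> and \<open>w\<close> have weight 1.\<close>

lemma Q_scale:
  "Q (c^2 * t) (c * z) (c * w) = c^3 * Q t z w"
  "Q_z (c^2 * t) (c * z) (c * w) = c^2 * Q_z t z w"
  "Q_w (c^2 * t) (c * z) (c * w) = c^2 * Q_w t z w"
  by (simp_all add: Q_defs algebra_simps numeral_eq_Suc)

lemma Phi_scale: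
  "Phi_t (c^2 * t) (c * z) (c * w) = c^5 * Phi_t t z w"
  "Phi_z (c^2 * t) (c * z) (c * w) = c^6 * Phi_z t z w"
  "Phi_w (c^2 * t) (c * z) (c * w) = c^6 * Phi_w t z w"
  unfolding Phi_t_def Phi_z_def Phi_w_def Q_scale
  by (simp_all add: algebra_simps numeral_eq_Suc)

lemma critical_scale:
  assumes "critical u v z w"
  shows "critical (c * u) (c * v) (c * z) (c * w)"
proof -
  have t: "c * u * (c * v) = c^2 * (u * v)" by (simp add: power2_eq_square mult_ac)
  have "(c * x)^6 + c * y * (c^5 * s) = c^6 * (x^6 + y * s)" for x y s
    by (simp add: algebra_simps numeral_eq_Suc)
  thus ?thesis using assms by (simp add: critical_def t Phi_scale)
qed

text \<open>On the plane section \<open>y = 0\<close>, that is \<open>u = v = x\<close> and \<open>t = x\<^sup>2\<close>, these are the singular points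
  with \<open>w = 1\<close> off the axis \<open>x = 0\<close>: there \<open>x^5 = - Phi_t\<close> determines \<open>x\<close> from \<open>(t, z)\<close> as \<open>- Phi_t / t\<^sup>2\<close>.\<close>

definition profile_nodes :: "('a::comm_ring_1 \<times> 'a) set" where
  "profile_nodes = {(t, z). t \<noteq> 0 \<and> (Phi_t t z 1)^2 = t^5 \<and> Phi_z t z 1 = 0 \<and> Phi_w t z 1 = 0}"

context
  assumes five: "(5::'a::field) = 0"
begin

lemma critical_zero_product:
  fixes u v z w :: 'a
  assumes "critical u v z w" "u * v = 0"
  shows "u = 0" "v = 0"
  using assms by (auto simp: critical_def)

text \<open>Modulo 5 and for \<open>w = 0\<close>, the derivatives factor as \<open>Phi_w = t z\<^sup>2 (t - z\<^sup>2)\<close> and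
  \<open>Phi_z = t\<^sup>2 (2 t - z\<^sup>2)\<close>, which leaves only \<open>t = 0\<close>.\<close>

lemma critical_at_infinity:
  fixes u v z :: 'a
  shows "critical u v z 0 \<longleftrightarrow> u = 0 \<and> v = 0"
proof
  assume crit: "critical u v z 0"
  define t where "t = u * v"
  have "Phi_w t z 0 = t * z^2 * (t - z^2)" "Phi_z t z 0 = t^2 * (2 * t - z^2)"
    by (simp_all add: Phi_derivative_defs Q_defs algebra_simps numeral_eq_Suc, simp_all add: numeral_mod5[OF five])
  hence w: "t * z^2 * (t - z^2) = 0" and z: "t^2 * (2 * t - z^2) = 0"
    using crit by (simp_all add: critical_def t_def)
  have "t = 0"
  proof (rule ccontr)
    assume t: "t \<noteq> 0"
    have z2: "z^2 = 2 * t" using z t by simp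
    have "t * (2 * t) * (t - 2 * t) = 0" using w by (simp only: z2)
    thus False using t two_nonzero_mod5[OF five] by simp
  qed
  hence "u * v = 0" by (simp only: t_def)
  thus "u = 0 \<and> v = 0" using critical_zero_product[OF crit] by blast
next
  assume "u = 0 \<and> v = 0"
  thus "critical u v z 0"
    by (simp add: critical_def Phi_derivative_defs Q_defs algebra_simps numeral_eq_Suc, simp add: numeral_mod5[OF five])
qed

text \<open>For \<open>t = 0\<close> the factor \<open>Q\<close> of \<open>Phi_w\<close> and \<open>Phi_z\<close> have no common zero, while the other factor is
  \<open>- (z + 1) (z + 2)\<close>, and \<open>Phi_z\<close> excludes \<open>z = - 2\<close>.\<close>

lemma critical_on_axis:
  fixes u v z :: 'a
  assumes "u * v = 0"
  shows "critical u v z 1 \<longleftrightarrow> u = 0 \<and> v = 0 \<and> z = - 1"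
proof
  assume crit: "critical u v z 1"
  have uv: "u = 0" "v = 0" using critical_zero_product[OF crit assms] .
  hence w: "Phi_w 0 z 1 = 0" and z: "Phi_z 0 z 1 = 0" using crit by (simp_all add: critical_def)
  have "z = - 1"
  proof (cases "Q 0 z 1 = 0")
    case True
    have "z = 0" using z two_nonzero_mod5[OF five] by (simp add: Phi_z_def True numeral_mod5[OF five])
    thus ?thesis using True two_nonzero_mod5[OF five] by (simp add: Q_def numeral_mod5[OF five])
  next
    case False
    have "Q 0 z 1 + (z + 2) * Q_w 0 z 1 = 0" using w False two_nonzero_mod5[OF five] by (simp add: Phi_w_def)
    moreover have "Q 0 z 1 + (z + 2) * Q_w 0 z 1 = - ((z + 1) * (z + 2))"
      by (simp add: Q_defs algebra_simps numeral_eq_Suc, simp add: numeral_mod5[OF five])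
    ultimately have "z = - 1 \<or> z = - 2" by (simp add: eq_neg_iff_add_eq_0)
    moreover have "Phi_z 0 (- 2) 1 \<noteq> (0::'a)"
      using two_nonzero_mod5[OF five] by (simp add: Phi_z_def Q_defs numeral_mod5[OF five])
    ultimately show ?thesis using z by auto
  qed
  thus "u = 0 \<and> v = 0 \<and> z = - 1" using uv by simp
next
  assume "u = 0 \<and> v = 0 \<and> z = - 1"
  thus "critical u v z 1"
    by (simp add: critical_def Phi_derivative_defs Q_defs numeral_mod5[OF five])
qed

text \<open>Multiplying the first two equations by \<open>u\<close> and \<open>v\<close> gives \<open>u^7 = v^7 = - t Phi_t\<close>. The product of
  these two seventh powers is \<open>t^7\<close>, which is the condition \<open>Phi_t\<^sup>2 = t^5\<close> on \<open>(t, z)\<close>. Conversely,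
  this condition makes the equation for \<open>v = t / u\<close> follow from the one for \<open>u\<close>.\<close>

lemma critical_off_axis:
  fixes u t z :: 'a
  assumes t: "t \<noteq> 0"
  shows "u * v = t \<and> critical u v z 1 \<longleftrightarrow>
    (t, z) \<in> profile_nodes \<and> u^7 = - t * Phi_t t z 1 \<and> v = t / u" (is "?L \<longleftrightarrow> ?R")
proof
  assume ?L
  hence uv: "u * v = t" and u: "u \<noteq> 0" and v: "v \<noteq> 0" using t by auto
  define p where "p = Phi_t t z 1"
  have "u^6 + v * p = 0" "v^6 + u * p = 0" using \<open>?L\<close> by (auto simp: critical_def p_def)
  hence "u * (u^6 + v * p) = 0" "v * (v^6 + u * p) = 0" by simp_all
  hence "u^7 + t * p = 0" "v^7 + t * p = 0"
    by (simp_all add: algebra_simps numeral_eq_Suc flip: uv)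
  hence u7: "u^7 = - t * p" and v7: "v^7 = - t * p" by (simp_all add: eq_neg_iff_add_eq_0)
  have "t^7 = u^7 * v^7" by (simp add: uv[symmetric] power_mult_distrib)
  also have "\<dots> = t^2 * p^2" by (simp add: u7 v7 power2_eq_square)
  finally have "t^2 * t^5 = t^2 * p^2" by (simp flip: power_add)
  hence "p^2 = t^5" using t by (metis mult_left_cancel power_not_zero)
  thus ?R using \<open>?L\<close> t u u7 uv by (auto simp: profile_nodes_def critical_def p_def field_simps)
next
  assume R: ?R
  define p where "p = Phi_t t z 1"
  have u7: "u^7 = - t * p" and p2: "p^2 = t^5" and v: "v = t / u"
    using R by (simp_all add: profile_nodes_def p_def)
  have p: "p \<noteq> 0" using p2 t by auto
  have u: "u \<noteq> 0" using u7 t p by auto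
  have uv: "u * v = t" using v u by simp
  have "u * (u^6 + v * p) = 0" using u7 uv by (simp add: numeral_eq_Suc algebra_simps)
  moreover have "v * (v^6 + u * p) = 0"
  proof -
    have "u^7 * (v * (v^6 + u * p)) = (u * v)^7 + u^7 * (u * v) * p"
      by (simp add: algebra_simps power_mult_distrib numeral_eq_Suc)
    also have "\<dots> = t^2 * (t^5 - p^2)"
      unfolding uv u7 by (simp add: algebra_simps numeral_eq_Suc)
    finally show ?thesis using p2 u by simp
  qed
  moreover have "v \<noteq> 0" using uv t by auto
  ultimately show ?L
    using R u uv by (simp add: critical_def profile_nodes_def p_def)
qed

end

section \<open>The profile nodes\<close>

text \<open>On a component of \<open>Phi_w = 0\<close> one has \<open>t = N / D\<close> with \<open>N\<close> and \<open>D\<close> polynomials in \<open>z\<close>.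
  Multiplying by a power of \<open>D\<close> turns the derivatives of \<open>Phi\<close> into polynomials in \<open>z\<close>.\<close>

lemma clear_denominators:
  fixes t z D N q r :: "'a::comm_ring_1"
  assumes N: "t * D = N" and q: "Q t z 1 * D = q" and r: "Q_z t z 1 * D = r"
  shows "Phi_t t z 1 * D^2 =
      6 * z * N^2 - 2 * z^3 * N * D + 2 * z^5 * D^2 - 2 * (z + 2) * (z + 1) * q * D"
    and "Phi_z t z 1 * D^3 =
      2 * N^3 - 3 * z^2 * N^2 * D + 10 * z^4 * N * D^2 + 7 * z^6 * D^3 - q^2 * D - 2 * (z + 2) * q * r * D"
    and "Phi_tt t z 1 * D = 12 * z * N - 2 * z^3 * D - 2 * (z + 2) * (z + 1)^2 * D"
    and "Phi_tz t z 1 * D^2 =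
      6 * N^2 - 6 * z^2 * N * D + 10 * z^4 * D^2 - 2 * (2 * z + 3) * q * D - 2 * (z + 2) * (z + 1) * r * D"
    and "Phi_zz t z 1 * D^2 =
      - 6 * z * N^2 + 40 * z^3 * N * D + 42 * z^5 * D^2 - 4 * q * r
      - 2 * (z + 2) * (r^2 + q * (24 * z + 2) * D)"
  unfolding Phi_derivative_defs N[symmetric] q[symmetric] r[symmetric]
  by (simp_all add: algebra_simps numeral_eq_Suc)

text \<open>The numerators, without factors that vanish only where \<open>t = 0\<close>, that \<open>Phi_z\<close> takes after
  eliminating \<open>t\<close> by \<open>Q = 0\<close> (case A) and by \<open>Q + (z + 2) Q_w = 0\<close> (case B).\<close>

definition nodal_A :: "'a::comm_ring_1 poly" where
  "nodal_A = [:2, 2, 0, - 2, - 2, - 1, - 2, 0, - 2, 1:]"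

definition nodal_B :: "'a::comm_ring_1 poly" where
  "nodal_B = [:0, 1, - 1, 1, 2, 1:]"

definition profile_hessian :: "'a::comm_ring_1 \<Rightarrow> 'a \<Rightarrow> 'a" where
  "profile_hessian t z = Phi_tt t z 1 * Phi_zz t z 1 - (Phi_tz t z 1)^2"

context
  assumes five: "(5::'a::field) = 0"
begin

text \<open>The cofactors in this and the following Bezout identities are those of the extended
  Euclidean algorithm.\<close>

lemma nodal_A_separable:
  "nodal_A * [:- 1, 2, 0, 0, 0, 1, 0, 2:] + pderiv nodal_A * [:- 1, - 1, 0, 2, 2, - 2, 2, - 1, 2:]
    = (1 :: 'a poly)"
  by (simp add: nodal_A_def pderiv_pCons numeral_mod5[OF five] one_pCons)

lemma nodal_B_separable:
  "nodal_B * [:2, 2:] + pderiv nodal_B * [:1, 0, 2, 1:] = (1 :: 'a poly)"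
  by (simp add: nodal_B_def pderiv_pCons numeral_mod5[OF five] one_pCons)

lemma nodal_coprime:
  "nodal_A * [:- 2, 2, 1, - 2, 2:] + nodal_B * [:0, - 1, 2, - 2, - 2, - 2, 2, 0, - 2:] = (1 :: 'a poly)"
  by (simp add: nodal_A_def nodal_B_def numeral_mod5[OF five] one_pCons)

text \<open>Case A: the equation \<open>Q = 0\<close> reads \<open>t (z + 1) = z^3 - z\<^sup>2 + 2 z + 1\<close> modulo 5.\<close>

lemma numerators_A:
  fixes t z :: 'a
  assumes tD: "t * (z + 1) = z^3 - z^2 + 2 * z + 1"
  shows "Phi_t t z 1 * (z + 1)^2 = z^7 + 2 * z^6 + 2 * z^4 - z^2 + z"
    and "Phi_z t z 1 * (z + 1)^3 = poly nodal_A z"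
    and "Phi_tt t z 1 * (z + 1) = z^3 - 2 * z^4 + z^2 - 2 * z + 1"
    and "Phi_tz t z 1 * (z + 1)^2 = z^4 - z^6 - 2 * z^5 - z^3 + 2 * z^2 + z"
    and "Phi_zz t z 1 * (z + 1)^2 = z^4 - 2 * z^7 - z^6 - 2 * z^5 - 2 * z^3 + 2 * z^2 - 2 * z + 1"
proof -
  define D where "D = z + 1"
  have N: "t * D = z^3 - z^2 + 2 * z + 1" using tD by (simp only: D_def)
  have "Q t z 1 * D = (z + 1) * (t * D) + (4 * z^3 + z^2 + 3 * z + 4) * D"
    by (simp add: Q_def algebra_simps)
  also have "\<dots> = 0"
    unfolding N unfolding D_def by (simp add: algebra_simps numeral_eq_Suc, simp add: numeral_mod5[OF five])
  finally have Q: "Q t z 1 * D = 0" .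
  have "Q_z t z 1 * D = t * D + (12 * z^2 + 2 * z + 3) * D"
    by (simp add: Q_z_def algebra_simps)
  also have "\<dots> = 2 * z - 2 * z^3 - 2 * z^2 - 1"
    unfolding N unfolding D_def by (simp add: algebra_simps numeral_eq_Suc, simp add: numeral_mod5[OF five])
  finally have Q_z: "Q_z t z 1 * D = 2 * z - 2 * z^3 - 2 * z^2 - 1" .
  note clear = clear_denominators[OF N Q Q_z, unfolded D_def]
  show "Phi_t t z 1 * (z + 1)^2 = z^7 + 2 * z^6 + 2 * z^4 - z^2 + z"
    unfolding clear by (simp add: algebra_simps numeral_eq_Suc, simp add: numeral_mod5[OF five])
  show "Phi_z t z 1 * (z + 1)^3 = poly nodal_A z"
    unfolding clear by (simp add: nodal_A_def algebra_simps numeral_eq_Suc, simp add: numeral_mod5[OF five])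
  show "Phi_tt t z 1 * (z + 1) = z^3 - 2 * z^4 + z^2 - 2 * z + 1"
    unfolding clear by (simp add: algebra_simps numeral_eq_Suc, simp add: numeral_mod5[OF five])
  show "Phi_tz t z 1 * (z + 1)^2 = z^4 - z^6 - 2 * z^5 - z^3 + 2 * z^2 + z"
    unfolding clear by (simp add: algebra_simps numeral_eq_Suc, simp add: numeral_mod5[OF five])
  show "Phi_zz t z 1 * (z + 1)^2 = z^4 - 2 * z^7 - z^6 - 2 * z^5 - 2 * z^3 + 2 * z^2 - 2 * z + 1"
    unfolding clear by (simp add: algebra_simps numeral_eq_Suc, simp add: numeral_mod5[OF five])
qed

text \<open>Case B: the terms with \<open>z^3\<close> cancel in \<open>Q + (z + 2) Q_w\<close>, and
  \<open>t (2 z - 2) = z\<^sup>2 - 2 z + 2\<close> remains. The numerator of \<open>Phi_z\<close> has the additional factor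
  \<open>(z + 1)\<^sup>2\<close>; at its zero \<open>z = - 1\<close> also \<open>t\<close> vanishes, which is the critical point on the axis.\<close>

lemma numerators_B:
  fixes t z :: 'a
  assumes tD: "t * (2 * z - 2) = z^2 - 2 * z + 2"
  shows "Phi_t t z 1 * (2 * z - 2)^2 = z^7 + z^6 + z^5 + 2 * z^4 + z^3 + 2 * z^2 + z + 2"
    and "Phi_z t z 1 * (2 * z - 2)^3 = 2 * (z + 1)^2 * poly nodal_B z"
    and "Phi_tt t z 1 * (2 * z - 2) = 2 * z^4 - z^3 + 2 * z^2 + z - 2"
    and "Phi_tz t z 1 * (2 * z - 2)^2 = 2 * z^4 + 2 * z^3 - 2 * z^2 - z"
    and "Phi_zz t z 1 * (2 * z - 2)^2 = 2 * z^4 - z^5 - z^3 + 2 * z^2 - z - 1"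
proof -
  define D where "D = 2 * z - 2"
  have N: "t * D = z^2 - 2 * z + 2" using tD by (simp only: D_def)
  have "Q t z 1 * D = (z + 1) * (t * D) + (4 * z^3 + z^2 + 3 * z + 4) * D"
    by (simp add: Q_def algebra_simps)
  also have "\<dots> = 2 * z - 2 * z^4 - 2 * z^2 - 1"
    unfolding N unfolding D_def by (simp add: algebra_simps numeral_eq_Suc, simp add: numeral_mod5[OF five])
  finally have Q: "Q t z 1 * D = 2 * z - 2 * z^4 - 2 * z^2 - 1" .
  have "Q_z t z 1 * D = t * D + (12 * z^2 + 2 * z + 3) * D"
    by (simp add: Q_z_def algebra_simps)
  also have "\<dots> = z^2 - z^3 + 1"
    unfolding N unfolding D_def by (simp add: algebra_simps numeral_eq_Suc, simp add: numeral_mod5[OF five])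
  finally have Q_z: "Q_z t z 1 * D = z^2 - z^3 + 1" .
  note clear = clear_denominators[OF N Q Q_z, unfolded D_def]
  show "Phi_t t z 1 * (2 * z - 2)^2 = z^7 + z^6 + z^5 + 2 * z^4 + z^3 + 2 * z^2 + z + 2"
    unfolding clear by (simp add: algebra_simps numeral_eq_Suc, simp add: numeral_mod5[OF five])
  show "Phi_z t z 1 * (2 * z - 2)^3 = 2 * (z + 1)^2 * poly nodal_B z"
    unfolding clear by (simp add: nodal_B_def algebra_simps numeral_eq_Suc, simp add: numeral_mod5[OF five])
  show "Phi_tt t z 1 * (2 * z - 2) = 2 * z^4 - z^3 + 2 * z^2 + z - 2"
    unfolding clear by (simp add: algebra_simps numeral_eq_Suc, simp add: numeral_mod5[OF five])
  show "Phi_tz t z 1 * (2 * z - 2)^2 = 2 * z^4 + 2 * z^3 - 2 * z^2 - z"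
    unfolding clear by (simp add: algebra_simps numeral_eq_Suc, simp add: numeral_mod5[OF five])
  show "Phi_zz t z 1 * (2 * z - 2)^2 = 2 * z^4 - z^5 - z^3 + 2 * z^2 - z - 1"
    unfolding clear by (simp add: algebra_simps numeral_eq_Suc, simp add: numeral_mod5[OF five])
qed

lemma denominator_A:
  fixes z :: 'a
  assumes root: "poly nodal_A z = 0"
  shows "z + 1 \<noteq> 0"
proof -
  have "(z + 1) * poly [:- 1, - 1, 1, 1, 1, 0, 2, - 2, - 1:] z + poly nodal_A z * poly [:1:] z = 1"
    by (simp add: nodal_A_def algebra_simps numeral_eq_Suc, simp add: numeral_mod5[OF five])
  thus ?thesis using root by auto
qed

text \<open>Given a root of \<open>nodal_A\<close>, the conditions on \<open>(t, z)\<close> are equations and inequalities between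
  polynomials in \<open>z\<close>: for an equation \<open>nodal_A\<close> divides its numerator, for an inequality it is
  coprime to the numerator.\<close>

lemma profile_node_A:
  fixes t z :: 'a
  assumes tD: "t * (z + 1) = z^3 - z^2 + 2 * z + 1" and root: "poly nodal_A z = 0"
  shows "(t, z) \<in> profile_nodes" "profile_hessian t z \<noteq> 0"
proof -
  define D N where "D = z + 1" and "N = z^3 - z^2 + 2 * z + 1"
  note numerators = numerators_A[OF tD, folded D_def]
  have N: "t * D = N" using tD by (simp add: D_def N_def)
  have D: "D \<noteq> 0" using denominator_A[OF root] by (simp add: D_def)
  have "N * poly [:- 1, 1, 0, 1, - 2, - 2, - 2, 2, 1:] z + poly nodal_A z * poly [:1, 2, - 1:] z = 1"
    by (simp add: nodal_A_def N_def algebra_simps numeral_eq_Suc, simp add: numeral_mod5[OF five])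
  hence t: "t \<noteq> 0" using root N by auto
  have "Phi_z t z 1 = 0" using numerators(2) D root by simp
  moreover have "Phi_w t z 1 = 0"
  proof -
    have "Q t z 1 = t * D - N"
      by (simp add: Q_def Q_w_def D_def N_def algebra_simps numeral_eq_Suc, simp add: numeral_mod5[OF five])
    thus ?thesis using N by (simp add: Phi_w_def mult.commute)
  qed
  moreover have "(Phi_t t z 1)^2 = t^5"
  proof -
    have "((Phi_t t z 1)^2 - t^5) * D^5 = D * (Phi_t t z 1 * D^2)^2 - (t * D)^5"
      by (simp add: algebra_simps numeral_eq_Suc)
    also have "\<dots> = poly nodal_A z * poly [:2, - 2, 0, - 1, - 2:] z"
      unfolding numerators N unfolding D_def N_def nodal_A_def
      by (simp add: algebra_simps numeral_eq_Suc, simp add: numeral_mod5[OF five])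
    finally show ?thesis using root D by simp
  qed
  ultimately show "(t, z) \<in> profile_nodes" using t by (simp add: profile_nodes_def)
  show "profile_hessian t z \<noteq> 0"
  proof
    assume 0: "profile_hessian t z = 0"
    have "profile_hessian t z * D^4 = (Phi_tt t z 1 * D) * (Phi_zz t z 1 * D^2) * D - (Phi_tz t z 1 * D^2)^2"
      by (simp add: profile_hessian_def algebra_simps numeral_eq_Suc)
    hence "((z^3 - 2 * z^4 + z^2 - 2 * z + 1) * (z^4 - 2 * z^7 - z^6 - 2 * z^5 - 2 * z^3 + 2 * z^2 - 2 * z + 1) * (z + 1)
        - (z^4 - z^6 - 2 * z^5 - z^3 + 2 * z^2 + z)^2) = 0"
      unfolding 0 numerators by (simp add: D_def)
    moreover have "((z^3 - 2 * z^4 + z^2 - 2 * z + 1) * (z^4 - 2 * z^7 - z^6 - 2 * z^5 - 2 * z^3 + 2 * z^2 - 2 * z + 1) * (z + 1)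
        - (z^4 - z^6 - 2 * z^5 - z^3 + 2 * z^2 + z)^2) * poly [:1, 1, - 2, - 1, 2, 1, 1:] z + poly nodal_A z * poly [:0, 1, - 2, - 2, 0, - 1, 0, 2, 1, 2:] z = 1"
      unfolding nodal_A_def by (simp add: algebra_simps numeral_eq_Suc, simp add: numeral_mod5[OF five])
    ultimately show False using root by simp
  qed
qed

lemma denominator_B:
  fixes z :: 'a
  assumes root: "poly nodal_B z = 0"
  shows "2 * z - 2 \<noteq> 0"
proof -
  have "(2 * z - 2) * poly [:2, - 1, 2, - 1, - 2:] z + poly nodal_B z * poly [:- 1:] z = 1"
    by (simp add: nodal_B_def algebra_simps numeral_eq_Suc, simp add: numeral_mod5[OF five])
  thus ?thesis using root by auto
qed

lemma profile_node_B:
  fixes t z :: 'a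
  assumes tD: "t * (2 * z - 2) = z^2 - 2 * z + 2" and root: "poly nodal_B z = 0"
  shows "(t, z) \<in> profile_nodes" "profile_hessian t z \<noteq> 0"
proof -
  define D N where "D = 2 * z - 2" and "N = z^2 - 2 * z + 2"
  note numerators = numerators_B[OF tD, folded D_def]
  have N: "t * D = N" using tD by (simp add: D_def N_def)
  have D: "D \<noteq> 0" using denominator_B[OF root] by (simp add: D_def)
  have "N * poly [:- 2, - 1, 1, - 2, - 1:] z + poly nodal_B z * poly [:- 2, 1:] z = 1"
    by (simp add: nodal_B_def N_def algebra_simps numeral_eq_Suc, simp add: numeral_mod5[OF five])
  hence t: "t \<noteq> 0" using root N by auto
  have "Phi_z t z 1 = 0" using numerators(2) D root by simp
  moreover have "Phi_w t z 1 = 0"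
  proof -
    have "Q t z 1 + (z + 2) * Q_w t z 1 = D * t - N"
      by (simp add: Q_def Q_w_def D_def N_def algebra_simps numeral_eq_Suc, simp add: numeral_mod5[OF five])
    thus ?thesis using N by (simp add: Phi_w_def mult.commute)
  qed
  moreover have "(Phi_t t z 1)^2 = t^5"
  proof -
    have "((Phi_t t z 1)^2 - t^5) * D^5 = D * (Phi_t t z 1 * D^2)^2 - (t * D)^5"
      by (simp add: algebra_simps numeral_eq_Suc)
    also have "\<dots> = poly nodal_B z * poly [:0, 0, 2, 0, - 1, - 1, 0, 2, - 1, - 2, 2:] z"
      unfolding numerators N unfolding D_def N_def nodal_B_def
      by (simp add: algebra_simps numeral_eq_Suc, simp add: numeral_mod5[OF five])
    finally show ?thesis using root D by simp
  qed
  ultimately show "(t, z) \<in> profile_nodes" using t by (simp add: profile_nodes_def)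
  show "profile_hessian t z \<noteq> 0"
  proof
    assume 0: "profile_hessian t z = 0"
    have "profile_hessian t z * D^4 = (Phi_tt t z 1 * D) * (Phi_zz t z 1 * D^2) * D - (Phi_tz t z 1 * D^2)^2"
      by (simp add: profile_hessian_def algebra_simps numeral_eq_Suc)
    hence "((2 * z^4 - z^3 + 2 * z^2 + z - 2) * (2 * z^4 - z^5 - z^3 + 2 * z^2 - z - 1) * (2 * z - 2)
        - (2 * z^4 + 2 * z^3 - 2 * z^2 - z)^2) = 0"
      unfolding 0 numerators by (simp add: D_def)
    moreover have "((2 * z^4 - z^3 + 2 * z^2 + z - 2) * (2 * z^4 - z^5 - z^3 + 2 * z^2 - z - 1) * (2 * z - 2)
        - (2 * z^4 + 2 * z^3 - 2 * z^2 - z)^2) * poly [:1, 0, 2, 2, - 1:] z + poly nodal_B z * poly [:- 2, 1, 1, 1, - 2, - 2, - 1, - 2, 0, 1:] z = 1"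
      unfolding nodal_B_def by (simp add: algebra_simps numeral_eq_Suc, simp add: numeral_mod5[OF five])
    ultimately show False using root by simp
  qed
qed

text \<open>The equations \<open>Phi_w = 0\<close> and \<open>Phi_z = 0\<close> and the condition \<open>t \<noteq> 0\<close> force \<open>z\<close> to be a root
  of one of the two polynomials; at these roots \<open>Phi_t\<^sup>2 = t^5\<close> holds as well.\<close>

lemma profile_nodes_iff:
  fixes t z :: 'a
  shows "(t, z) \<in> profile_nodes \<longleftrightarrow>
    poly nodal_A z = 0 \<and> t * (z + 1) = z^3 - z^2 + 2 * z + 1 \<or>
    poly nodal_B z = 0 \<and> t * (2 * z - 2) = z^2 - 2 * z + 2" (is "_ \<longleftrightarrow> ?A \<or> ?B")
proof
  assume node: "(t, z) \<in> profile_nodes"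
  hence t: "t \<noteq> 0" and z: "Phi_z t z 1 = 0" and w: "Phi_w t z 1 = 0"
    by (simp_all add: profile_nodes_def)
  from w two_nonzero_mod5[OF five] consider "Q t z 1 = 0" | "Q t z 1 + (z + 2) * Q_w t z 1 = 0"
    by (auto simp: Phi_w_def)
  thus "?A \<or> ?B"
  proof cases
    case 1
    have "Q t z 1 = t * (z + 1) - (z^3 - z^2 + 2 * z + 1)"
      by (simp add: Q_def algebra_simps numeral_eq_Suc, simp add: numeral_mod5[OF five])
    hence tD: "t * (z + 1) = z^3 - z^2 + 2 * z + 1" using 1 by simp
    thus ?thesis using numerators_A(2)[OF tD] z by simp
  next
    case 2
    have "Q t z 1 + (z + 2) * Q_w t z 1 = t * (2 * z - 2) - (z^2 - 2 * z + 2)"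
      by (simp add: Q_def Q_w_def algebra_simps numeral_eq_Suc, simp add: numeral_mod5[OF five])
    hence tD: "t * (2 * z - 2) = z^2 - 2 * z + 2" using 2 by simp
    have "z + 1 \<noteq> 0"
    proof
      assume "z + 1 = 0"
      hence "z = - 1" by (simp add: eq_neg_iff_add_eq_0)
      thus False using tD t by (simp add: numeral_mod5[OF five])
    qed
    thus ?thesis using numerators_B(2)[OF tD] z tD two_nonzero_mod5[OF five] by simp
  qed
qed (use profile_node_A(1) profile_node_B(1) in blast)

lemma profile_hessian_nonzero:
  fixes t z :: 'a
  assumes "(t, z) \<in> profile_nodes"
  shows "profile_hessian t z \<noteq> 0"
  using assms profile_node_A(2) profile_node_B(2) unfolding profile_nodes_iff by blast

lemma profile_nodes_eq_image:
  "profile_nodes =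
     (\<lambda>z. ((z^3 - z^2 + 2 * z + 1) / (z + 1), z :: 'a)) ` {z. poly nodal_A z = 0} \<union>
     (\<lambda>z. ((z^2 - 2 * z + 2) / (2 * z - 2), z)) ` {z. poly nodal_B z = 0}"
proof -
  have "t * d = n \<longleftrightarrow> t = n / d" if "d \<noteq> 0" for t d n :: 'a
    using that by (auto simp: field_simps)
  thus ?thesis
    using denominator_A denominator_B by (auto simp: profile_nodes_iff image_iff)
qed

end

lemma card_profile_nodes:
  assumes five: "(5::'a::alg_closed_field) = 0"
  shows "card (profile_nodes :: ('a \<times> 'a) set) = 14"
proof -
  let ?A = "{z::'a. poly nodal_A z = 0}" and ?B = "{z::'a. poly nodal_B z = 0}"
  have "poly (pderiv nodal_A) z \<noteq> 0" if "poly nodal_A z = 0" for z :: 'a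
    using arg_cong[OF nodal_A_separable[OF five], of "\<lambda>p. poly p z"] that
    by (auto simp only: poly_add poly_mult poly_1 mult_zero_left add_0_left zero_neq_one)
  hence "card ?A = degree (nodal_A :: 'a poly)" by (rule card_roots_separable)
  hence A: "card ?A = 9" by (simp add: nodal_A_def)
  have "poly (pderiv nodal_B) z \<noteq> 0" if "poly nodal_B z = 0" for z :: 'a
    using arg_cong[OF nodal_B_separable[OF five], of "\<lambda>p. poly p z"] that
    by (auto simp only: poly_add poly_mult poly_1 mult_zero_left add_0_left zero_neq_one)
  hence "card ?B = degree (nodal_B :: 'a poly)" by (rule card_roots_separable)
  hence B: "card ?B = 5" by (simp add: nodal_B_def)
  have disjoint: "\<not> (poly nodal_A z = 0 \<and> poly nodal_B z = 0)" for z :: 'a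
    using arg_cong[OF nodal_coprime[OF five], of "\<lambda>p. poly p z"]
    by (auto simp only: poly_add poly_mult poly_1 mult_zero_left add_0_left zero_neq_one)
  have "finite ?A" "finite ?B" using A B by (auto intro: card_ge_0_finite)
  thus ?thesis
    unfolding profile_nodes_eq_image[OF five]
    by (subst card_Un_disjoint) (use disjoint in \<open>auto simp: card_image inj_on_def A B\<close>)
qed

section \<open>Counting the affine critical points\<close>

text \<open>One point on the axis, and over each of the 14 profile nodes the 7 solutions of
  \<open>u^7 = - t Phi_t\<close>, which are distinct since 7 is invertible and the right-hand side is nonzero.\<close>

lemma finite_card_affine_critical:
  assumes five: "(5::'a::alg_closed_field) = 0"
  shows "finite {(u, v, z :: 'a). critical u v z 1}" "card {(u, v, z :: 'a). critical u v z 1} = 99"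
proof -
  let ?fibre = "\<lambda>(t::'a, z). {u. u^7 = - t * Phi_t t z 1}"
  let ?off = "(\<lambda>((t, z), u). (u, t / u, z)) ` Sigma profile_nodes ?fibre"
  have nz: "t \<noteq> 0 \<and> Phi_t t z 1 \<noteq> 0" if "(t, z) \<in> profile_nodes" for t z :: 'a
    using that by (auto simp: profile_nodes_def)
  have u: "u \<noteq> 0" if "(t, z) \<in> profile_nodes" "u^7 = - t * Phi_t t z 1" for t z u :: 'a
    using nz[OF that(1)] that(2) by auto
  have "(of_nat 7 :: 'a) \<noteq> 0"
    using two_nonzero_mod5[OF five] by (simp add: numeral_mod5[OF five])
  hence fibre: "card (?fibre x) = 7" if "x \<in> profile_nodes" for x
    using that nz by (cases x) (auto intro!: card_nth_roots)
  have fin: "finite (profile_nodes :: ('a \<times> 'a) set)"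
    by (rule card_ge_0_finite) (simp add: card_profile_nodes[OF five])
  have fin_fibre: "finite (?fibre x)" if "x \<in> profile_nodes" for x
    by (rule card_ge_0_finite) (subst fibre[OF that], simp)
  have fin_sigma: "finite (Sigma profile_nodes ?fibre)"
    using fin fin_fibre by (rule finite_SigmaI)
  have "card (Sigma profile_nodes ?fibre) = 14 * 7"
    using fin fin_fibre fibre by (simp add: card_SigmaI card_profile_nodes[OF five])
  moreover have "inj_on (\<lambda>((t, z), u). (u, t / u, z)) (Sigma profile_nodes ?fibre)"
    using u by (auto simp: inj_on_def)
  ultimately have card: "card ?off = 98" by (simp add: card_image)
  have eq: "{(u, v, z :: 'a). critical u v z 1} = insert (0, 0, - 1) ?off"
  proof (intro equalityI subsetI)
    fix x assume "x \<in> {(u, v, z :: 'a). critical u v z 1}"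
    then obtain u v z where x: "x = (u, v, z)" and crit: "critical u v z 1" by auto
    show "x \<in> insert (0, 0, - 1) ?off"
    proof (cases "u * v = 0")
      case True
      thus ?thesis using critical_on_axis[OF five True] crit x by simp
    next
      case False
      hence "(u * v, z) \<in> profile_nodes \<and> u^7 = - (u * v) * Phi_t (u * v) z 1 \<and> v = u * v / u"
        using critical_off_axis[OF five False, of u v z] crit by blast
      thus ?thesis unfolding x by (intro insertI2 image_eqI[of _ _ "((u * v, z), u)"]) auto
    qed
  next
    fix x assume "x \<in> insert (0, 0, - 1) ?off"
    thus "x \<in> {(u, v, z :: 'a). critical u v z 1}"
    proof
      assume "x = (0, 0, - 1)"
      thus ?thesis using critical_on_axis[OF five, of 0 0 "- 1"] by simp
    next
      assume "x \<in> ?off"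
      then obtain t z u where "x = (u, t / u, z)" "(t, z) \<in> profile_nodes" "u^7 = - t * Phi_t t z 1"
        by auto
      thus ?thesis using critical_off_axis[OF five, of t u "t / u" z] nz by auto
    qed
  qed
  have "(0, 0, - 1) \<notin> ?off" using u by auto
  thus "finite {(u, v, z :: 'a). critical u v z 1}" "card {(u, v, z :: 'a). critical u v z 1} = 99"
    unfolding eq using card fin_sigma by simp_all
qed

section \<open>The singular points of the septic\<close>

definition symmetric_septic :: "'a::comm_ring_1 mpoly" where
  "symmetric_septic = Psi (mvar 0 + 2 * mvar 1) (mvar 0 - 2 * mvar 1) (mvar 2) (mvar 3)"

text \<open>The vector of homogeneous coordinates \<open>x, y, z, w\<close> that has the given \<open>u\<close> and \<open>v\<close>: modulo 5 the
  equations \<open>u = x + 2 y\<close>, \<open>v = x - 2 y\<close> have the solution \<open>x = 3 (u + v)\<close>, \<open>y = v - u\<close>.\<close>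

definition point :: "'a::comm_ring_1 \<Rightarrow> 'a \<Rightarrow> 'a \<Rightarrow> 'a \<Rightarrow> 'a vec" where
  "point u v z w = vec 4 (\<lambda>i. [3 * (u + v), v - u, z, w] ! i)"

lemma point_carrier: "point u v z w \<in> carrier_vec 4"
  by (simp add: point_def)

lemma point_index:
  "point u v z w $ 0 = 3 * (u + v)" "point u v z w $ 1 = v - u"
  "point u v z w $ 2 = z" "point u v z w $ 3 = w"
  by (simp_all add: point_def)

lemma less_four_iff: "j < 4 \<longleftrightarrow> j = 0 \<or> j = 1 \<or> j = 2 \<or> j = (3::nat)"
  by arith

lemma point_scale: "c \<cdot>\<^sub>v point u v z w = point (c * u) (c * v) (c * z) (c * w)"
  by (rule eq_vecI) (auto simp: point_def less_four_iff algebra_simps)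

context
  assumes five: "(5::'a::alg_closed_field) = 0"
begin

lemma point_surj:
  fixes v :: "'a vec"
  assumes "v \<in> carrier_vec 4"
  shows "v = point (v $ 0 + 2 * v $ 1) (v $ 0 - 2 * v $ 1) (v $ 2) (v $ 3)"
proof (rule eq_vecI)
  fix j assume "j < dim_vec (point (v $ 0 + 2 * v $ 1) (v $ 0 - 2 * v $ 1) (v $ 2) (v $ 3))"
  hence "j = 0 \<or> j = 1 \<or> j = 2 \<or> j = 3"
    using point_carrier by (metis carrier_vecD less_four_iff)
  thus "v $ j = point (v $ 0 + 2 * v $ 1) (v $ 0 - 2 * v $ 1) (v $ 2) (v $ 3) $ j"
    by (elim disjE) (simp_all only: point_index, simp_all add: numeral_mod5[OF five])
qed (use assms point_carrier in \<open>metis carrier_vecD\<close>)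

lemma point_symmetric_coordinates:
  fixes u v z w :: 'a
  shows "point u v z w $ 0 + 2 * point u v z w $ 1 = u"
    "point u v z w $ 0 - 2 * point u v z w $ 1 = v"
  unfolding point_index by (simp_all add: algebra_simps numeral_mod5[OF five])

lemma point_eq_iff:
  fixes u v z w :: 'a
  shows "point u v z w = point u' v' z' w' \<longleftrightarrow> u = u' \<and> v = v' \<and> z = z' \<and> w = w'"
  by (metis point_index(3,4) point_symmetric_coordinates)

lemma point_zero: "point 0 0 0 0 = (0\<^sub>v 4 :: 'a vec)"
  using point_surj[of "0\<^sub>v 4"] by simp

text \<open>Euler's formula for a form of degree \<open>7 = 2\<close>: since 7 is invertible modulo 5, the surface
  contains every common zero of its partial derivatives.\<close>

lemma Psi_euler:
  fixes u v z w :: 'a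
  assumes "critical u v z w"
  shows "Psi u v z w = 0"
proof -
  \<comment> \<open>The coefficient 2 is the degree 7 modulo 5.\<close>
  have "2 * Psi u v z w = u * (u^6 + v * Phi_t (u * v) z w) + v * (v^6 + u * Phi_t (u * v) z w)
      + z * Phi_z (u * v) z w + w * Phi_w (u * v) z w"
    by (simp add: Psi_def Phi_def Phi_derivative_defs Q_defs algebra_simps numeral_eq_Suc, simp add: numeral_mod5[OF five])
  thus ?thesis using assms two_nonzero_mod5[OF five] by (simp add: critical_def)
qed

text \<open>The derivatives with respect to \<open>x\<close> and \<open>y\<close> are \<open>a + b\<close> and \<open>2 (a - b)\<close>, where \<open>a\<close> and \<open>b\<close> are the
  derivatives with respect to \<open>u\<close> and \<open>v\<close>.\<close>

lemma singular_vectors_symmetric_septic: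
  "point u v z w \<in> singular_vectors (symmetric_septic :: 'a mpoly) \<longleftrightarrow>
     critical u v z w \<and> \<not> (u = 0 \<and> v = 0 \<and> z = 0 \<and> w = 0)"
proof -
  let ?ev = "meval id (\<lambda>i. point u v z w $ i)"
  interpret comm_ring_hom ?ev by (rule meval_id_hom)
  have ev_mvar: "?ev (mvar i) = point u v z w $ i" for i
    by (rule meval_mvar[OF comm_ring_hom_id])
  define a b where "a = u^6 + v * Phi_t (u * v) z w" and "b = v^6 + u * Phi_t (u * v) z w"
  have ab: "21 * u^6 + v * Phi_t (u * v) z w = a" "21 * v^6 + u * Phi_t (u * v) z w = b"
    by (simp_all add: a_def b_def numeral_mod5[OF five])
  define U V :: "'a mpoly" where "U = mvar 0 + 2 * mvar 1" and "V = mvar 0 - 2 * mvar 1"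
  have "?ev U = point u v z w $ 0 + 2 * point u v z w $ 1"
    "?ev V = point u v z w $ 0 - 2 * point u v z w $ 1"
    unfolding U_def V_def by (simp_all only: hom_distribs ev_mvar)
  hence "?ev U = u" "?ev V = v" by (simp_all only: point_symmetric_coordinates)
  moreover have "?ev (mvar 2) = z" "?ev (mvar 3) = w" by (simp_all only: ev_mvar point_index)
  ultimately have ev: "?ev U = u" "?ev V = v" "?ev (mvar 2) = z" "?ev (mvar 3) = w" .
  have F: "symmetric_septic = Psi U V (mvar 2) (mvar 3)"
    by (simp only: symmetric_septic_def U_def V_def)
  have D: "?ev (mderiv j symmetric_septic) = a * ?ev (mderiv j U) + b * ?ev (mderiv j V)
      + Phi_z (u * v) z w * ?ev (mderiv j (mvar 2)) + Phi_w (u * v) z w * ?ev (mderiv j (mvar 3))" for j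
    by (simp only: F mderiv_Psi hom_distribs ev comm_ring_hom_Phi_derivatives[OF meval_id_hom] flip: ab)
  have "?ev symmetric_septic = Psi u v z w"
    by (simp only: F comm_ring_hom_Psi[OF meval_id_hom] ev)
  moreover have "?ev (mderiv 0 symmetric_septic) = a + b" "?ev (mderiv 1 symmetric_septic) = 2 * (a - b)"
    "?ev (mderiv 2 symmetric_septic) = Phi_z (u * v) z w"
    "?ev (mderiv 3 symmetric_septic) = Phi_w (u * v) z w"
    unfolding D by (simp_all add: U_def V_def mderiv_simps mderiv_mvar hom_distribs algebra_simps)
  moreover have "a + b = 0 \<and> 2 * (a - b) = 0 \<longleftrightarrow> a = 0 \<and> b = 0"
  proof
    assume *: "a + b = 0 \<and> 2 * (a - b) = 0"
    hence "a = b" using two_nonzero_mod5[OF five] by simp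
    moreover from this have "2 * a = 0" using conjunct1[OF *] by (simp only: mult_2)
    ultimately show "a = 0 \<and> b = 0" using two_nonzero_mod5[OF five] by simp
  qed simp
  moreover have "point u v z w = 0\<^sub>v 4 \<longleftrightarrow> u = 0 \<and> v = 0 \<and> z = 0 \<and> w = 0"
    unfolding point_zero[symmetric] point_eq_iff ..
  moreover have "(\<forall>j<4. ?ev (mderiv j symmetric_septic) = 0) \<longleftrightarrow>
      (?ev (mderiv 0 symmetric_septic) = 0 \<and> ?ev (mderiv 1 symmetric_septic) = 0) \<and>
      ?ev (mderiv 2 symmetric_septic) = 0 \<and> ?ev (mderiv 3 symmetric_septic) = 0"
    unfolding less_four_iff by blast
  ultimately show ?thesis
    using Psi_euler[of u v z w] point_carrier[of u v z w]
    by (auto simp: singular_vectors_def critical_def simp flip: a_def b_def)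
qed

text \<open>Representatives are normalized by \<open>w = 1\<close>, and by \<open>z = 1\<close> for the only singular point with
  \<open>w = 0\<close>.\<close>

definition node_representatives :: "'a vec set" where
  "node_representatives =
     insert (point 0 0 1 0) ((\<lambda>(u, v, z). point u v z 1) ` {(u, v, z). critical u v z 1})"

lemma node_representatives_iff:
  "point u v z w \<in> node_representatives \<longleftrightarrow>
     critical u v z w \<and> (w = 1 \<or> w = 0 \<and> z = (1 :: 'a))"
proof -
  have "point u v z w \<in> (\<lambda>(u, v, z). point u v z 1) ` {(u, v, z). critical u v z 1} \<longleftrightarrow>
      w = 1 \<and> critical u v z 1"
    by (auto simp: image_iff point_eq_iff)
  thus ?thesis
    by (auto simp: node_representatives_def point_eq_iff critical_at_infinity[OF five])
qed

lemma card_node_representatives: "card (node_representatives :: 'a vec set) = 100"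
proof -
  let ?A = "(\<lambda>(u, v, z :: 'a). point u v z 1) ` {(u, v, z). critical u v z 1}"
  have "inj_on (\<lambda>(u, v, z :: 'a). point u v z 1) {(u, v, z). critical u v z 1}"
    by (auto simp: inj_on_def point_eq_iff)
  hence "card ?A = 99" "finite ?A"
    using finite_card_affine_critical[OF five] by (simp_all add: card_image)
  moreover have "point 0 0 1 0 \<notin> ?A" by (auto simp: point_eq_iff)
  ultimately show ?thesis by (simp add: node_representatives_def)
qed

lemma bij_betw_node_representatives:
  "bij_betw (\<lambda>v. proj_rel `` {v}) node_representatives (singular_points (symmetric_septic :: 'a mpoly))"
proof (rule bij_betw_singular_points)
  fix v :: "'a vec" assume v: "v \<in> singular_vectors symmetric_septic"
  hence "v \<in> carrier_vec 4" by (simp add: singular_vectors_def)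
  then obtain x y z w where p: "v = point x y z w" using point_surj by blast
  have crit: "critical x y z w" and nz: "\<not> (x = 0 \<and> y = 0 \<and> z = 0 \<and> w = 0)"
    using v unfolding p singular_vectors_symmetric_septic by blast+
  show "c \<cdot>\<^sub>v v \<in> singular_vectors symmetric_septic" if "c \<noteq> 0" for c
    using critical_scale[OF crit, of c] nz that
    unfolding p point_scale singular_vectors_symmetric_septic by simp
  show "\<exists>c. c \<noteq> 0 \<and> c \<cdot>\<^sub>v v \<in> node_representatives"
  proof (cases "w = 0")
    case True
    hence "x = 0" "y = 0" using crit critical_at_infinity[OF five, of x y z] by auto
    hence "z \<noteq> 0" using nz True by simp
    thus ?thesis
      using critical_scale[OF crit, of "inverse z"] True
      unfolding p point_scale node_representatives_iff
      by (intro exI[of _ "inverse z"]) simp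
  next
    case False
    thus ?thesis
      using critical_scale[OF crit, of "inverse w"]
      unfolding p point_scale node_representatives_iff
      by (intro exI[of _ "inverse w"]) simp
  qed
next
  show "node_representatives \<subseteq> (singular_vectors symmetric_septic :: 'a vec set)"
  proof
    fix r :: "'a vec" assume r: "r \<in> node_representatives"
    then obtain x y z w where p: "r = point x y z w" by (auto simp: node_representatives_def)
    show "r \<in> singular_vectors symmetric_septic"
      using r unfolding p node_representatives_iff singular_vectors_symmetric_septic by auto
  qed
next
  fix c and r :: "'a vec" assume r: "r \<in> node_representatives" "c \<noteq> 0" "c \<cdot>\<^sub>v r \<in> node_representatives"
  then obtain x y z w where p: "r = point x y z w" by (auto simp: node_representatives_def)
  have "c = 1 \<or> x = 0 \<and> y = 0 \<and> w = 0 \<and> c * z = 1 \<and> z = 1"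
    using r critical_at_infinity[OF five, of x y z] unfolding p point_scale node_representatives_iff by auto
  thus "c \<cdot>\<^sub>v r = r" by (auto simp: p point_scale)
qed

text \<open>Here \<open>a, b, c, p, q, r\<close> stand for the second derivatives \<open>uu, uv, vv, us, vs, ss\<close> in coordinates
  \<open>u, v\<close> and a third coordinate \<open>s\<close>. The change of coordinates to \<open>x, y\<close> has determinant \<open>- 4\<close>, and the
  Hessian determinant is multiplied by its square 16, which is 1 modulo 5.\<close>

lemma det_hessian_symmetric:
  fixes f :: "'a mpoly" and a b c p q r :: 'a
  assumes "\<And>j k. j < 3 \<Longrightarrow> k < 3 \<Longrightarrow> meval id x (mderiv j (mderiv k f)) =
     [[a + 2 * b + c, 2 * (a - c), p + q], [2 * (a - c), 4 * (a - 2 * b + c), 2 * (p - q)],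
      [p + q, 2 * (p - q), r]] ! j ! k"
  shows "det (hessian f x) = (a * c - b^2) * r - a * q^2 - c * p^2 + 2 * b * p * q"
proof -
  have "det (hessian f x) = 16 * ((a * c - b^2) * r - a * q^2 - c * p^2 + 2 * b * p * q)"
    unfolding hessian_def det_3 by (simp add: assms) (simp add: algebra_simps power2_eq_square)
  thus ?thesis by (simp add: numeral_mod5[OF five])
qed

lemma local_equation_symmetric_septic:
  "local_equation 3 symmetric_septic =
     Psi (mvar 0 + 2 * mvar 1) (mvar 0 - 2 * mvar 1) (mvar 2) (1 :: 'a mpoly)"
  "local_equation 2 symmetric_septic =
     Psi (mvar 0 + 2 * mvar 1) (mvar 0 - 2 * mvar 1) 1 (mvar 2 :: 'a mpoly)"
proof -
  interpret comm_ring_hom "meval mconst v :: 'a mpoly \<Rightarrow> 'a mpoly" for v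
    by (rule meval_comm_ring_hom[OF comm_ring_hom_mconst])
  note simps = local_equation_def symmetric_septic_def hom_distribs
    comm_ring_hom_Psi[OF meval_comm_ring_hom[OF comm_ring_hom_mconst]] meval_mvar[OF comm_ring_hom_mconst]
  show "local_equation 3 symmetric_septic =
     Psi (mvar 0 + 2 * mvar 1) (mvar 0 - 2 * mvar 1) (mvar 2) (1 :: 'a mpoly)"
    "local_equation 2 symmetric_septic =
     Psi (mvar 0 + 2 * mvar 1) (mvar 0 - 2 * mvar 1) 1 (mvar 2 :: 'a mpoly)"
    by (simp_all add: simps)
qed

text \<open>Both charts in use, \<open>w = 1\<close> and \<open>z = 1\<close>, are covered by letting \<open>Z\<close> and \<open>W\<close> depend on the third
  affine coordinate with constant slopes \<open>e\<close> and \<open>d\<close>: these are \<open>1, 0\<close> and \<open>0, 1\<close>.\<close>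

lemma hessian_entries:
  fixes x :: "nat \<Rightarrow> 'a" and Z W :: "'a mpoly"
  defines "U \<equiv> mvar 0 + 2 * mvar 1" and "V \<equiv> mvar 0 - 2 * mvar 1"
  assumes Z: "mderiv 0 Z = 0" "mderiv 1 Z = 0" "mderiv 2 Z = mconst e"
    and W: "mderiv 0 W = 0" "mderiv 1 W = 0" "mderiv 2 W = mconst d"
    and u: "u = x 0 + 2 * x 1" and v: "v = x 0 - 2 * x 1"
    and z: "z = meval id x Z" and w: "w = meval id x W"
    and t: "t = u * v"
    and j: "j < 3" and k: "k < 3"
  shows "meval id x (mderiv j (mderiv k (Psi U V Z W))) = (let
      a = u^5 + v^2 * Phi_tt t z w; b = Phi_t t z w + t * Phi_tt t z w; c = v^5 + u^2 * Phi_tt t z w;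
      p = v * (Phi_tz t z w * e + Phi_tw t z w * d); q = u * (Phi_tz t z w * e + Phi_tw t z w * d);
      r = Phi_zz t z w * e^2 + 2 * Phi_zw t z w * e * d + Phi_ww t z w * d^2
    in [[a + 2 * b + c, 2 * (a - c), p + q], [2 * (a - c), 4 * (a - 2 * b + c), 2 * (p - q)],
      [p + q, 2 * (p - q), r]] ! j ! k)"
proof -
  let ?ev = "meval id x"
  interpret comm_ring_hom ?ev by (rule meval_id_hom)
  have ev_mvar: "?ev (mvar i) = x i" for i by (rule meval_mvar[OF comm_ring_hom_id])
  have ev: "?ev U = u" "?ev V = v" "?ev Z = z" "?ev W = w"
    by (simp_all only: u v z w U_def V_def hom_distribs ev_mvar)
  have ev_mconst: "?ev (mconst c) = c" for c
    using meval_single[OF comm_ring_hom_id, of x 0 c] by (simp add: mconst_def monomial_value_def)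
  have U: "mderiv 0 U = 1" "mderiv 1 U = 2" "mderiv 2 U = 0"
    and V: "mderiv 0 V = 1" "mderiv 1 V = - 2" "mderiv 2 V = 0"
    by (simp_all add: U_def V_def mderiv_simps mderiv_mvar)
  have "j = 0 \<or> j = 1 \<or> j = 2" "k = 0 \<or> k = 1 \<or> k = 2" using j k by arith+
  thus ?thesis
    by (elim disjE) (simp_all add: mderiv_Psi mderiv_simps mderiv_Phi_t mderiv_Phi_z mderiv_Phi_w U V Z W mderiv_mconst hom_distribs ev ev_mconst
     comm_ring_hom_Phi_derivatives[OF meval_id_hom] t Let_def del: One_nat_def,
     simp_all add: algebra_simps numeral_eq_Suc numeral_mod5[OF five])
qed

text \<open>The expanded determinant contains \<open>u^7 + v^7\<close>, which the critical equations replace by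
  \<open>- 2 t Phi_t\<close>. What remains depends on \<open>t\<close> and \<open>z\<close> only, in accordance with the symmetry.\<close>

lemma node_at_affine_point:
  fixes u v z :: 'a
  assumes crit: "critical u v z 1"
  shows "det (hessian (local_equation 3 symmetric_septic) (chart_coords 3 (point u v z 1))) \<noteq> 0"
proof -
  let ?x = "chart_coords 3 (point u v z 1)"
  have x: "?x 0 = point u v z 1 $ 0" "?x 1 = point u v z 1 $ 1" "?x 2 = z"
    by (simp_all add: chart_coords_def point_index)
  define t where "t = u * v"
  define ft ftt ftz fzz where "ft = Phi_t t z 1" and "ftt = Phi_tt t z 1"
    and "ftz = Phi_tz t z 1" and "fzz = Phi_zz t z 1"
  interpret comm_ring_hom "meval id ?x" by (rule meval_id_hom)
  have u: "u^6 + v * ft = 0" and v: "v^6 + u * ft = 0"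
    using crit by (simp_all add: critical_def ft_def t_def)
  have "det (hessian (local_equation 3 symmetric_septic) ?x) =
      ((u^5 + v^2 * ftt) * (v^5 + u^2 * ftt) - (ft + t * ftt)^2) * fzz
      - (u^5 + v^2 * ftt) * (u * ftz)^2 - (v^5 + u^2 * ftt) * (v * ftz)^2
      + 2 * (ft + t * ftt) * (v * ftz) * (u * ftz)"
    unfolding local_equation_symmetric_septic
  proof (rule det_hessian_symmetric, goal_cases)
    case (1 j k)
    show ?case
      using hessian_entries[of "mvar 2" 1 1 0 u ?x v z 1 t j k] 1
      by (simp add: x point_symmetric_coordinates mderiv_mvar mderiv_1 mconst_def meval_mvar comm_ring_hom_id
        hom_distribs Let_def t_def ft_def ftt_def ftz_def fzz_def del: One_nat_def)
  qed
  \<comment> \<open>The terms with \<open>u^7\<close> and \<open>v^7\<close> are completed to the left-hand sides of the critical equations.\<close>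
  also have "\<dots> = fzz * (t^5 - ft^2 - 4 * t * ft * ftt) + 4 * t * ft * ftz^2
      + (u * (u^6 + v * ft) + v * (v^6 + u * ft)) * (ftt * fzz - ftz^2)"
    unfolding t_def by (simp add: algebra_simps numeral_eq_Suc)
  finally have det: "det (hessian (local_equation 3 symmetric_septic) ?x) =
      fzz * (t^5 - ft^2 - 4 * t * ft * ftt) + 4 * t * ft * ftz^2" by (simp add: u v)
  show ?thesis
  proof (cases "t = 0")
    case True
    hence "z = - 1" using critical_on_axis[OF five, of u v z] crit by (simp add: t_def)
    thus ?thesis
      unfolding det True using two_nonzero_mod5[OF five]
      by (simp add: True ft_def fzz_def Phi_derivative_defs Q_defs numeral_mod5[OF five])
  next
    case False
    hence node: "(t, z) \<in> profile_nodes"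
      using critical_off_axis[OF five, of t u v z] crit t_def by blast
    hence ft: "ft^2 = t^5" and "ft \<noteq> 0" by (auto simp: profile_nodes_def ft_def)
    have "det (hessian (local_equation 3 symmetric_septic) ?x) = t * ft * profile_hessian t z"
      unfolding det profile_hessian_def ft ft_def[symmetric] ftt_def[symmetric] ftz_def[symmetric]
        fzz_def[symmetric]
      by (simp add: algebra_simps numeral_mod5[OF five])
    thus ?thesis using False \<open>ft \<noteq> 0\<close> profile_hessian_nonzero[OF five node] by simp
  qed
qed

lemma node_at_infinite_point:
  "det (hessian (local_equation 2 symmetric_septic) (chart_coords 2 (point 0 0 1 (0 :: 'a)))) \<noteq> 0"
proof -
  let ?x = "chart_coords 2 (point 0 0 1 (0 :: 'a))"
  interpret comm_ring_hom "meval id ?x" by (rule meval_id_hom)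
  have x: "?x 0 = 0" "?x 1 = 0" "?x 2 = 0"
    by (simp_all add: chart_coords_def point_index del: One_nat_def)
  have "det (hessian (local_equation 2 symmetric_septic) ?x) =
      (0 * 0 - (Phi_t 0 1 0)^2) * Phi_ww 0 1 0 - 0 * 0^2 - 0 * 0^2 + 2 * Phi_t 0 1 0 * 0 * 0"
    unfolding local_equation_symmetric_septic
  proof (rule det_hessian_symmetric, goal_cases)
    case (1 j k)
    show ?case
      using hessian_entries[of 1 0 "mvar 2" 1 0 ?x 0 1 0 0 j k] 1
      by (simp add: x mderiv_mvar mderiv_1 mconst_def meval_mvar comm_ring_hom_id
        hom_distribs Let_def del: One_nat_def)
  qed
  thus ?thesis using two_nonzero_mod5[OF five] by (simp add: Phi_derivative_defs Q_defs numeral_mod5[OF five])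
qed

lemma singular_points_symmetric_septic_are_nodes:
  assumes "p \<in> singular_points (symmetric_septic :: 'a mpoly)"
  shows "is_node symmetric_septic p"
proof -
  obtain r where r: "r \<in> node_representatives" "p = proj_rel `` {r}"
    using assms bij_betw_node_representatives by (auto simp: bij_betw_def)
  obtain u v z w where uvzw: "r = point u v z w" using r(1) by (auto simp: node_representatives_def)
  have "r \<in> singular_vectors symmetric_septic"
    using r(1) unfolding uvzw node_representatives_iff singular_vectors_symmetric_septic by auto
  hence "r \<in> carrier_vec 4 - {0\<^sub>v 4}" by (simp add: singular_vectors_def)
  hence "r \<in> p" using r(2) equiv_class_self[OF equiv_proj_rel] by blast
  have crit: "critical u v z w" and "w = 1 \<or> w = 0 \<and> z = 1"
    using r(1) by (simp_all add: uvzw node_representatives_iff)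
  thus ?thesis
  proof (elim disjE conjE)
    assume "w = 1"
    hence "r $ 3 = 1" "det (hessian (local_equation 3 symmetric_septic) (chart_coords 3 r)) \<noteq> 0"
      using node_at_affine_point crit by (simp_all add: uvzw point_index)
    moreover have "(3::nat) < 4" by simp
    ultimately show ?thesis using assms \<open>r \<in> p\<close> unfolding is_node_def by blast
  next
    assume "w = 0" "z = 1"
    hence "r = point 0 0 1 0" using crit critical_at_infinity[OF five] by (simp add: uvzw)
    hence "r $ 2 = 1" "det (hessian (local_equation 2 symmetric_septic) (chart_coords 2 r)) \<noteq> 0"
      using node_at_infinite_point by (simp_all add: point_index)
    moreover have "(2::nat) < 4" by simp
    ultimately show ?thesis using assms \<open>r \<in> p\<close> unfolding is_node_def by blast
  qed
qed

end

lemma homogeneous_septic: "homogeneous 7 (septic alpha5)"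
proof -
  note intros = homogeneous_add homogeneous_diff homogeneous_mult homogeneous_power
    homogeneous_numeral homogeneous_mvar
  let ?u = "mvar 0 + 2 * mvar 1 :: F5 mpoly" and ?v = "mvar 0 - 2 * mvar 1 :: F5 mpoly"
  have uv: "homogeneous 1 ?u" "homogeneous 1 ?v"
    using homogeneous_add[OF homogeneous_mvar[of 0] homogeneous_mult[OF homogeneous_numeral homogeneous_mvar[of 1]]]
      homogeneous_diff[OF homogeneous_mvar[of 0] homogeneous_mult[OF homogeneous_numeral homogeneous_mvar[of 1]]]
    by simp_all
  have "\<exists>d. homogeneous d (septic alpha5) \<and> d = 7"
    unfolding septic_eq_Psi Psi_def Phi_def Q_def
    by (intro exI conjI) (rule intros uv | simp)+
  thus ?thesis by simp
qed

lemma septic_nonzero: "septic alpha5 \<noteq> 0"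
proof
  let ?ev = "meval id (\<lambda>i::nat. if i = 0 then 1 else 0 :: F5)"
  interpret comm_ring_hom ?ev by (rule meval_id_hom)
  assume "septic alpha5 = 0"
  hence "?ev (septic alpha5) = 0" by simp
  moreover have "?ev (septic alpha5) = 1"
    by (simp add: septic_eq_Psi comm_ring_hom_Psi[OF meval_id_hom] hom_distribs meval_mvar comm_ring_hom_id
        Psi_def Phi_def Q_def numeral_mod5[OF five_F5])
  ultimately show False by simp
qed

theorem corollary4:
  shows "7 * alpha5 ^ 3 + 7 * alpha5 + 1 = 0 \<and>
    septic alpha5 \<noteq> 0 \<and> homogeneous 7 (septic alpha5) \<and>
    card (singular_points (geometric (septic alpha5))) = 100 \<and>
    (\<forall>p\<in>singular_points (geometric (septic alpha5)). is_node (geometric (septic alpha5)) p)"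
proof -
  have septic: "geometric (septic alpha5) = symmetric_septic"
    by (simp only: geometric_septic_eq_Psi symmetric_septic_def)
  have "7 * alpha5 ^ 3 + 7 * alpha5 + 1 = 0"
    by (simp add: alpha5_def numeral_mod5[OF five_F5])
  moreover have "card (singular_points (geometric (septic alpha5))) = 100"
    using bij_betw_same_card[OF bij_betw_node_representatives[OF five_ac]]
    by (simp add: septic card_node_representatives[OF five_ac])
  ultimately show ?thesis
    using septic_nonzero homogeneous_septic singular_points_symmetric_septic_are_nodes[OF five_ac]
    by (simp add: septic)
qed

end
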